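(* Let $S$ be a finite right restriction EI-Ehresmann semigroup and let $\Bbbk$ be a field. Let $J$ be a regular $\mathcal J$-class of $S$ and let $V$ be a simple $\Bbbk G_J$-module. Then $$\operatorname{Ind}_{G_J}(V)=\Bbbk\mathcal L(e)\bigotimes_{\Bbbk G_J}V$$ (for some idempotent $e\in J$) is a simple $\Bbbk S$-module. In fact, $$\{\operatorname{Ind}_{G_J}(V)\mid J\text{ is a regular }\mathcal J\text{-class of }S,\ V\in\operatorname{Irr}\Bbbk G_J\}$$ is a list of all the simple modules of $\Bbbk S$ up to isomorphism with no isomorphic copies.
   Context: A subsemilattice $E$ of a semigroup $S$ is a commutative subsemigroup of idempotents. Define equivalences on $S$: $a\,\widetilde{\mathcal L}_E\, b$ iff for all $e\in E$ ($ae=a\Leftrightarrow be=b$); $a\,\widetilde{\mathcal R}_E\, b$ iff for all $e\in E$ ($ea=a\Leftrightarrow eb=b$); $\widetilde{\mathcal H}_E=\widetilde{\mathcal L}_E\cap\widetilde{\mathcal R}_E$. $S$ is ($E$-)Ehresmann if every $\widetilde{\mathcal L}_E$-class and every $\widetilde{\mathcal R}_E$-class contains a unique element of $E$ (denoted $a^{*}$, resp. $a^{+}$, for the class of $a$), $\widetilde{\mathcal L}_E$ is a right congruence and $\widetilde{\mathcal R}_E$ is a left congruence. It is right restriction if $ea=a(ea)^{*}$ for all $a\in S$, $e\in E$. The category $\mathbf C(S)$ has object set $E$ and one morphism $C(a)$ for each $a\in S$, with domain $a^{*}$ and range $a^{+}$, and $C(b)C(a)=C(ba)$ when defined. $S$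 is EI-Ehresmann if every endomorphism in $\mathbf C(S)$ is an isomorphism; equivalently, the $\widetilde{\mathcal H}_E$-class of every $e\in E$ is a group. $\mathcal L,\mathcal R,\mathcal J,\mathcal H$ are Green's relations. A $\mathcal J$-class is regular if it contains a regular element (equivalently, since $S$ is finite, an idempotent). For an idempotent $e$, $\mathcal L(e)$ is its $\mathcal L$-class and $G_e$ its $\mathcal H$-class, the maximal subgroup with identity $e$; for idempotents $e$ in the same regular $\mathcal J$-class $J$ the groups $G_e$ are isomorphic, and $G_J$ denotes this group (identified with $G_e$ for the chosen $e$). $\Bbbk\mathcal L(e)$ is the $\Bbbk$-vector space with basis $\mathcal L(e)$; it is a $\Bbbk S$-$\Bbbk G_e$-bimodule, where $s\in S$ acts by $s\cdot x=sx$ if $sx\in\mathcal L(e)$ and $s\cdot x=0$ otherwise, and $G_e$ acts by right multiplication. The module $\operatorname{Ind}_{G_J}(V)$ does not depend, up to isomorphism, on the choice of the idempotent $e\in J$. $\operatorname{Irr}A$ is the set of simple $A$-modules (up to isomorphism). Algebras are unital and finite dimensional; modules are finite dimensional left modules. *)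

theory Defs
  imports "HOL-Algebra.Module" "HOL-Algebra.Free_Abelian_Groups"
begin

section \<open>Ehresmann semigroups\<close>

text \<open>The semigroup \<open>S\<close> is a whole type of class \<open>semigroup_mult\<close>; the distinguished
  subsemilattice \<open>E\<close> is a subset of it.\<close>

definition subsemilattice :: "'s::semigroup_mult set \<Rightarrow> bool" where
  "subsemilattice E \<longleftrightarrow>
     (\<forall>e\<in>E. e * e = e) \<and> (\<forall>e\<in>E. \<forall>f\<in>E. e * f \<in> E \<and> e * f = f * e)"

definition tildeL :: "'s::semigroup_mult set \<Rightarrow> 's \<Rightarrow> 's \<Rightarrow> bool" where
  "tildeL E a b \<longleftrightarrow> (\<forall>e\<in>E. a * e = a \<longleftrightarrow> b * e = b)"

definition tildeR :: "'s::semigroup_mult set \<Rightarrow> 's \<Rightarrow> 's \<Rightarrow> bool" where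
  "tildeR E a b \<longleftrightarrow> (\<forall>e\<in>E. e * a = a \<longleftrightarrow> e * b = b)"

definition Ehresmann :: "'s::semigroup_mult set \<Rightarrow> bool" where
  "Ehresmann E \<longleftrightarrow>
     subsemilattice E \<and>
     (\<forall>a. \<exists>!e. e \<in> E \<and> tildeL E a e) \<and>
     (\<forall>a. \<exists>!e. e \<in> E \<and> tildeR E a e) \<and>
     (\<forall>a b c. tildeL E a b \<longrightarrow> tildeL E (a * c) (b * c)) \<and>
     (\<forall>a b c. tildeR E a b \<longrightarrow> tildeR E (c * a) (c * b))"

text \<open>\<open>star E a\<close> and \<open>plus E a\<close> are \<open>a\<^sup>*\<close> and \<open>a\<^sup>+\<close>.\<close>

definition star :: "'s::semigroup_mult set \<Rightarrow> 's \<Rightarrow> 's" where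
  "star E a = (THE e. e \<in> E \<and> tildeL E a e)"

definition plus :: "'s::semigroup_mult set \<Rightarrow> 's \<Rightarrow> 's" where
  "plus E a = (THE e. e \<in> E \<and> tildeR E a e)"

definition right_restriction :: "'s::semigroup_mult set \<Rightarrow> bool" where
  "right_restriction E \<longleftrightarrow> Ehresmann E \<and> (\<forall>a. \<forall>e\<in>E. e * a = a * star E (e * a))"

record ('o, 'm) cat =
  Obj :: "'o set"
  Mor :: "'m set"
  Dom :: "'m \<Rightarrow> 'o"
  Ran :: "'m \<Rightarrow> 'o"
  Comp :: "'m \<Rightarrow> 'm \<Rightarrow> 'm"
  Ident :: "'o \<Rightarrow> 'm"

definition Hom :: "('o, 'm) cat \<Rightarrow> 'o \<Rightarrow> 'o \<Rightarrow> 'm set" where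
  "Hom C x y = {f \<in> Mor C. Dom C f = x \<and> Ran C f = y}"

text \<open>\<open>Comp C g f\<close> is "\<open>g\<close> after \<open>f\<close>"; it is meaningful only if \<open>Ran C f = Dom C g\<close>.\<close>

definition cat_iso :: "('o, 'm) cat \<Rightarrow> 'm \<Rightarrow> bool" where
  "cat_iso C f \<longleftrightarrow>
     (\<exists>g \<in> Hom C (Ran C f) (Dom C f).
        Comp C g f = Ident C (Dom C f) \<and> Comp C f g = Ident C (Ran C f))"

definition EI_category :: "('o, 'm) cat \<Rightarrow> bool" where
  "EI_category C \<longleftrightarrow> (\<forall>x \<in> Obj C. \<forall>f \<in> Hom C x x. cat_iso C f)"

text \<open>The category \<open>C(S)\<close>: the morphism \<open>C(a)\<close> is represented by \<open>a\<close> itself. The identity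
  at \<open>e\<close> is \<open>C(e)\<close>, because \<open>e\<^sup>* = e\<^sup>+ = e\<close> and \<open>a\<^sup>+ a = a = a a\<^sup>*\<close>.\<close>

definition cat_of :: "'s::semigroup_mult set \<Rightarrow> ('s, 's) cat" where
  "cat_of E = \<lparr>Obj = E, Mor = UNIV, Dom = star E, Ran = plus E,
               Comp = (\<lambda>b a. b * a), Ident = (\<lambda>e. e)\<rparr>"

definition EI_Ehresmann :: "'s::semigroup_mult set \<Rightarrow> bool" where
  "EI_Ehresmann E \<longleftrightarrow> Ehresmann E \<and> EI_category (cat_of E)"

section \<open>Green's relations\<close>

definition lideal1 :: "'s::semigroup_mult \<Rightarrow> 's set" where
  "lideal1 a = {a} \<union> {s * a |s. True}"

definition rideal1 :: "'s::semigroup_mult \<Rightarrow> 's set" where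
  "rideal1 a = {a} \<union> {a * s |s. True}"

definition ideal1 :: "'s::semigroup_mult \<Rightarrow> 's set" where
  "ideal1 a = {a} \<union> {s * a |s. True} \<union> {a * t |t. True} \<union> {s * a * t |s t. True}"

definition Lclass :: "'s::semigroup_mult \<Rightarrow> 's set" where
  "Lclass a = {b. lideal1 b = lideal1 a}"

definition Rclass :: "'s::semigroup_mult \<Rightarrow> 's set" where
  "Rclass a = {b. rideal1 b = rideal1 a}"

definition Hclass :: "'s::semigroup_mult \<Rightarrow> 's set" where
  "Hclass a = Lclass a \<inter> Rclass a"

definition Jclass :: "'s::semigroup_mult \<Rightarrow> 's set" where
  "Jclass a = {b. ideal1 b = ideal1 a}"

definition regular_element :: "'s::semigroup_mult \<Rightarrow> bool" where
  "regular_element a \<longleftrightarrow> (\<exists>x. a * x * a = a)"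

definition regular_Jclass :: "'s::semigroup_mult set \<Rightarrow> bool" where
  "regular_Jclass J \<longleftrightarrow> (\<exists>a. J = Jclass a) \<and> (\<exists>b\<in>J. regular_element b)"

section \<open>Semigroup algebras\<close>

definition convolution ::
  "('s::{semigroup_mult,finite} \<Rightarrow> 'k::field) \<Rightarrow> ('s \<Rightarrow> 'k) \<Rightarrow> 's \<Rightarrow> 'k" where
  "convolution f g = (\<lambda>u. \<Sum>(s, t) | s * t = u. f s * g t)"

text \<open>The algebra of a subsemigroup \<open>T\<close>, as the functions supported on \<open>T\<close>. The element \<open>one\<close>
  is the identity element of the algebra if there is one and is unspecified otherwise, in which
  case the structure is not a \<open>ring\<close>.\<close>

definition semigroup_algebra ::
  "'s::{semigroup_mult,finite} set \<Rightarrow> ('s \<Rightarrow> 'k::field) ring" where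
  "semigroup_algebra T =
     \<lparr>carrier = {f. \<forall>s. s \<notin> T \<longrightarrow> f s = 0},
      monoid.mult = convolution,
      one = (THE u. (\<forall>s. s \<notin> T \<longrightarrow> u s = 0) \<and>
                    (\<forall>f. (\<forall>s. s \<notin> T \<longrightarrow> f s = 0) \<longrightarrow>
                         convolution u f = f \<and> convolution f u = f)),
      ring.zero = (\<lambda>_. 0),
      ring.add = (\<lambda>f g s. f s + g s)\<rparr>"

section \<open>Modules\<close>

text \<open>The locale \<open>module\<close> requires a commutative ring of scalars; this is the same notion over an
  arbitrary ring. Modules, as there, are \<open>module\<close> records whose components \<open>mult\<close> and \<open>one\<close>
  play no role.\<close>

locale left_module = R?: ring R + M?: abelian_group M for R and M (structure) +
  assumes smult_closed:
      "\<lbrakk>a \<in> carrier R; x \<in> carrier M\<rbrakk> \<Longrightarrow> a \<odot>\<^bsub>M\<^esub> x \<in> carrier M"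
    and smult_l_distr:
      "\<lbrakk>a \<in> carrier R; b \<in> carrier R; x \<in> carrier M\<rbrakk> \<Longrightarrow>
       (a \<oplus>\<^bsub>R\<^esub> b) \<odot>\<^bsub>M\<^esub> x = a \<odot>\<^bsub>M\<^esub> x \<oplus>\<^bsub>M\<^esub> b \<odot>\<^bsub>M\<^esub> x"
    and smult_r_distr:
      "\<lbrakk>a \<in> carrier R; x \<in> carrier M; y \<in> carrier M\<rbrakk> \<Longrightarrow>
       a \<odot>\<^bsub>M\<^esub> (x \<oplus>\<^bsub>M\<^esub> y) = a \<odot>\<^bsub>M\<^esub> x \<oplus>\<^bsub>M\<^esub> a \<odot>\<^bsub>M\<^esub> y"
    and smult_assoc:
      "\<lbrakk>a \<in> carrier R; b \<in> carrier R; x \<in> carrier M\<rbrakk> \<Longrightarrow>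
       (a \<otimes>\<^bsub>R\<^esub> b) \<odot>\<^bsub>M\<^esub> x = a \<odot>\<^bsub>M\<^esub> (b \<odot>\<^bsub>M\<^esub> x)"
    and smult_one:
      "x \<in> carrier M \<Longrightarrow> \<one>\<^bsub>R\<^esub> \<odot>\<^bsub>M\<^esub> x = x"

text \<open>Finite dimension over the field \<open>'k\<close>, where \<open>c\<close> acts on a module as \<open>c \<cdot> 1\<close> does.\<close>

definition findim :: "('s \<Rightarrow> 'k::field) ring \<Rightarrow> ('s \<Rightarrow> 'k, 'v) module \<Rightarrow> bool" where
  "findim A M \<longleftrightarrow>
     (\<exists>B. finite B \<and> B \<subseteq> carrier M \<and>
        (\<forall>x \<in> carrier M. \<exists>c :: 'v \<Rightarrow> 'k.
           x = (\<Oplus>\<^bsub>M\<^esub>b\<in>B. (\<lambda>s. c b * \<one>\<^bsub>A\<^esub> s) \<odot>\<^bsub>M\<^esub> b)))"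

definition simple_module :: "('s \<Rightarrow> 'k::field) ring \<Rightarrow> ('s \<Rightarrow> 'k, 'v) module \<Rightarrow> bool" where
  "simple_module A M \<longleftrightarrow>
     left_module A M \<and> findim A M \<and> carrier M \<noteq> {\<zero>\<^bsub>M\<^esub>} \<and>
     (\<forall>N. submodule N A M \<longrightarrow> N = {\<zero>\<^bsub>M\<^esub>} \<or> N = carrier M)"

definition module_isomorphic ::
  "('a, 'c) ring_scheme \<Rightarrow> ('a, 'v) module \<Rightarrow> ('a, 'w) module \<Rightarrow> bool" where
  "module_isomorphic R M N \<longleftrightarrow>
     (\<exists>h. bij_betw h (carrier M) (carrier N) \<and>
        (\<forall>x\<in>carrier M. \<forall>y\<in>carrier M. h (x \<oplus>\<^bsub>M\<^esub> y) = h x \<oplus>\<^bsub>N\<^esub> h y) \<and>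
        (\<forall>a\<in>carrier R. \<forall>x\<in>carrier M. h (a \<odot>\<^bsub>M\<^esub> x) = a \<odot>\<^bsub>N\<^esub> h x))"

section \<open>Tensor products and induction\<close>

record ('a, 'b, 'm) bimodule = "('a, 'm) module" +
  rsmult :: "'m \<Rightarrow> 'b \<Rightarrow> 'm"

definition tensor_relations ::
  "('b, 'c) ring_scheme \<Rightarrow> ('a, 'b, 'm) bimodule \<Rightarrow> ('b, 'v) module \<Rightarrow> ('m \<times> 'v \<Rightarrow>\<^sub>0 int) set"
  where
  "tensor_relations R X V =
     {frag_of (x \<oplus>\<^bsub>X\<^esub> y, v) - frag_of (x, v) - frag_of (y, v) |x y v.
        x \<in> carrier X \<and> y \<in> carrier X \<and> v \<in> carrier V} \<union>
     {frag_of (x, v \<oplus>\<^bsub>V\<^esub> w) - frag_of (x, v) - frag_of (x, w) |x v w.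
        x \<in> carrier X \<and> v \<in> carrier V \<and> w \<in> carrier V} \<union>
     {frag_of (rsmult X x r, v) - frag_of (x, r \<odot>\<^bsub>V\<^esub> v) |x r v.
        x \<in> carrier X \<and> r \<in> carrier R \<and> v \<in> carrier V}"

text \<open>\<open>X \<otimes>\<^sub>R V\<close> is the free abelian group on \<open>X \<times> V\<close> modulo these relations, with
  \<open>a \<cdot> (x \<otimes> v) = (a \<cdot> x) \<otimes> v\<close>. The left action is computed on all representatives of a coset;
  for a bimodule \<open>X\<close> the union is again a single coset.\<close>

definition tensor_product ::
  "('b, 'c) ring_scheme \<Rightarrow> ('a, 'b, 'm) bimodule \<Rightarrow> ('b, 'v) module
     \<Rightarrow> ('a, ('m \<times> 'v \<Rightarrow>\<^sub>0 int) set) module"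
  where
  "tensor_product R X V =
     (let F = free_Abelian_group (carrier X \<times> carrier V);
          K = generate F (tensor_relations R X V)
      in \<lparr>carrier = carrier (F Mod K),
          monoid.mult = undefined, one = undefined,
          ring.zero = one (F Mod K),
          ring.add = monoid.mult (F Mod K),
          module.smult = (\<lambda>a Q. \<Union>c\<in>Q. K #>\<^bsub>F\<^esub> frag_extend (\<lambda>(x, v). frag_of (a \<odot>\<^bsub>X\<^esub> x, v)) c)\<rparr>)"

text \<open>The bimodule spanned by the \<open>L\<close>-class of \<open>e\<close>: products that leave the \<open>L\<close>-class are replaced
  by \<open>0\<close> in the left action, and cannot occur in the right one.\<close>

definition L_bimodule ::
  "'s::{semigroup_mult,finite} \<Rightarrow> ('s \<Rightarrow> 'k::field, 's \<Rightarrow> 'k, 's \<Rightarrow> 'k) bimodule" where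
  "L_bimodule e =
     \<lparr>carrier = {f. \<forall>s. s \<notin> Lclass e \<longrightarrow> f s = 0},
      monoid.mult = undefined, one = undefined,
      ring.zero = (\<lambda>_. 0),
      ring.add = (\<lambda>f g s. f s + g s),
      module.smult = (\<lambda>a f u. if u \<in> Lclass e then convolution a f u else 0),
      rsmult = convolution\<rparr>"

definition Ind ::
  "'s::{semigroup_mult,finite} \<Rightarrow> ('s \<Rightarrow> 'k::field, 'v) module
     \<Rightarrow> ('s \<Rightarrow> 'k, (('s \<Rightarrow> 'k) \<times> 'v \<Rightarrow>\<^sub>0 int) set) module" where
  "Ind e V = tensor_product (semigroup_algebra (Hclass e)) (L_bimodule e) V"

end

theory Submission
  imports Defs
begin

text \<open>In a right restriction EI-Ehresmann semigroup every idempotent \<open>e\<close> is \<open>\<R>\<close>-related to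
  \<open>e\<^sup>+ \<in> E\<close>. Hence the elements \<open>q = x y\<close> of \<open>E\<close> with \<open>y x = e\<close> separate the \<open>\<R>\<close>-classes inside
  \<open>\<L>(e)\<close>: since idempotents of \<open>E\<close> commute, each \<open>x \<in> \<L>(e)\<close> is fixed by exactly one such \<open>q\<close> and
  moved out of \<open>\<L>(e)\<close> by the others. So their sum acts as the identity on \<open>Ind(V)\<close>, and a nonzero
  vector \<open>t\<close> has some \<open>q t \<noteq> 0\<close>, whence \<open>y t\<close> is a nonzero vector of \<open>e Ind(V) = e \<otimes> V\<close>, which
  generates \<open>Ind(V)\<close> because \<open>V\<close> is simple.

  Conversely let \<open>M\<close> be simple and let \<open>f \<in> E\<close> be minimal with \<open>f M \<noteq> 0\<close>. If \<open>a \<in> fSf\<close> does not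
  annihilate \<open>M\<close>, neither do \<open>a\<^sup>+, a\<^sup>* \<le> f\<close>, so \<open>a\<close> is an endomorphism of \<open>f\<close> in the EI-category and
  lies in \<open>G\<^sub>f\<close>. This passes to every idempotent \<open>e\<close> that is \<open>\<J>\<close>-equivalent to \<open>f\<close>; then \<open>e M\<close> is a
  simple \<open>G\<^sub>e\<close>-module and \<open>x \<otimes> m \<mapsto> x m\<close> is an isomorphism from \<open>Ind(e M)\<close> to \<open>M\<close> by Schur's lemma.
  Finally \<open>J\<close> is recovered from \<open>Ind(V)\<close> as the least \<open>\<J>\<close>-class that does not annihilate it, and \<open>V\<close>
  as \<open>e Ind(V)\<close>.\<close>

section \<open>Green's relations of idempotents\<close>

text \<open>Since \<open>e = e * e\<close>, the generator that \<open>lideal1\<close> adjoins is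
  itself a left multiple, so equality of left ideals reduces to two equations. Membership in an
  L-class is handled in this form from here on.\<close>

lemma Lclass_idempotent_iff:
  fixes e :: "'s::semigroup_mult"
  assumes "e * e = e"
  shows "x \<in> Lclass e \<longleftrightarrow> x * e = x \<and> (\<exists>t. t * x = e)"
proof
  assume "x \<in> Lclass e"
  then have eq: "lideal1 x = lideal1 e" by (simp add: Lclass_def)
  have "x \<in> lideal1 e" using eq by (auto simp: lideal1_def)
  then have "x = e \<or> (\<exists>s. x = s * e)" by (auto simp: lideal1_def)
  then have "x * e = x" using assms by (auto simp: mult.assoc)
  moreover have "e \<in> lideal1 x" using eq by (auto simp: lideal1_def)
  then have "e = x \<or> (\<exists>s. e = s * x)" by (auto simp: lideal1_def)
  then have "\<exists>t. t * x = e" using assms by metis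
  ultimately show "x * e = x \<and> (\<exists>t. t * x = e)" by blast
next
  assume "x * e = x \<and> (\<exists>t. t * x = e)"
  then obtain t where t: "x * e = x" "t * x = e" by blast
  have "s * x = (s * x) * e" "s * e = (s * t) * x" for s
    using t by (simp_all add: mult.assoc)
  then show "x \<in> Lclass e"
    using t unfolding Lclass_def lideal1_def by (auto; metis)
qed

lemma Rclass_idempotent_iff:
  fixes e :: "'s::semigroup_mult"
  assumes "e * e = e"
  shows "x \<in> Rclass e \<longleftrightarrow> e * x = x \<and> (\<exists>t. x * t = e)"
proof
  assume "x \<in> Rclass e"
  then have eq: "rideal1 x = rideal1 e" by (simp add: Rclass_def)
  have "x \<in> rideal1 e" using eq by (auto simp: rideal1_def)
  then have "x = e \<or> (\<exists>s. x = e * s)" by (auto simp: rideal1_def)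
  then have "e * x = x" using assms by (auto simp flip: mult.assoc)
  moreover have "e \<in> rideal1 x" using eq by (auto simp: rideal1_def)
  then have "e = x \<or> (\<exists>s. e = x * s)" by (auto simp: rideal1_def)
  then have "\<exists>t. x * t = e" using assms by metis
  ultimately show "e * x = x \<and> (\<exists>t. x * t = e)" by blast
next
  assume "e * x = x \<and> (\<exists>t. x * t = e)"
  then obtain t where t: "e * x = x" "x * t = e" by blast
  have "x * s = e * (x * s)" "e * s = x * (t * s)" for s
    using t by (simp_all flip: mult.assoc)
  then show "x \<in> Rclass e"
    using t unfolding Rclass_def rideal1_def by (auto; metis)
qed

lemma Hclass_idempotent_iff:
  fixes e :: "'s::semigroup_mult"
  assumes "e * e = e"
  shows "x \<in> Hclass e \<longleftrightarrow> x * e = x \<and> e * x = x \<and> (\<exists>t. t * x = e) \<and> (\<exists>t. x * t = e)"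
  using Lclass_idempotent_iff[OF assms] Rclass_idempotent_iff[OF assms] by (auto simp: Hclass_def)

lemma Hclass_subset_Lclass: "Hclass e \<subseteq> Lclass e"
  by (simp add: Hclass_def)

lemma Hclass_self: "e \<in> Hclass e"
  by (simp add: Hclass_def Lclass_def Rclass_def)

lemma Hclass_mult_closed:
  fixes e :: "'s::semigroup_mult"
  assumes e: "e * e = e" and g: "g \<in> Hclass e" and h: "h \<in> Hclass e"
  shows "g * h \<in> Hclass e"
proof -
  from g obtain t u where g': "g * e = g" "e * g = g" "t * g = e" "g * u = e"
    using Hclass_idempotent_iff[OF e] by blast
  from h obtain v w where h': "h * e = h" "e * h = h" "v * h = e" "h * w = e"
    using Hclass_idempotent_iff[OF e] by blast
  have "(v * t) * (g * h) = v * ((t * g) * h)" "(g * h) * (w * u) = g * ((h * w) * u)"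
    by (simp_all add: mult.assoc)
  moreover have "v * ((t * g) * h) = e" "g * ((h * w) * u) = e"
    using g' h' by (simp_all flip: mult.assoc)
  ultimately show ?thesis
    using g' h' Hclass_idempotent_iff[OF e] by (metis mult.assoc)
qed

lemma Lclass_mult_Hclass:
  fixes e :: "'s::semigroup_mult"
  assumes e: "e * e = e" and x: "x \<in> Lclass e" and h: "h \<in> Hclass e"
  shows "x * h \<in> Lclass e"
proof -
  from x obtain t where t: "x * e = x" "t * x = e"
    using Lclass_idempotent_iff[OF e] by blast
  from h obtain v where v: "h * e = h" "e * h = h" "v * h = e"
    using Hclass_idempotent_iff[OF e] by blast
  have "(v * t) * (x * h) = v * ((t * x) * h)" by (simp add: mult.assoc)
  then have "(v * t) * (x * h) = e" using t v by simp
  then show ?thesis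
    using v Lclass_idempotent_iff[OF e] by (metis mult.assoc)
qed

text \<open>A left inverse \<open>t * s\<close> of the group element \<open>h\<close> is also a
  right inverse, so \<open>h * t\<close> takes \<open>s\<close> back to \<open>e\<close>. Together
  with \<open>Lclass_mult_Hclass\<close> this lets truncation to \<open>\<L>(e)\<close> commute with
  the right action of \<open>G\<^sub>e\<close>.\<close>

lemma Lclass_of_mult_Hclass:
  fixes e :: "'s::semigroup_mult"
  assumes e: "e * e = e" and h: "h \<in> Hclass e" and se: "s * e = s" and L: "s * h \<in> Lclass e"
  shows "s \<in> Lclass e"
proof -
  from h obtain v where v: "e * h = h" "h * v = e"
    using Hclass_idempotent_iff[OF e] by blast
  from L obtain t where "t * (s * h) = e"
    using Lclass_idempotent_iff[OF e] by blast
  then have t: "(t * s) * h = e" by (simp add: mult.assoc)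
  have "h * (t * s) = h * ((t * s) * (h * v))" using v se by (simp add: mult.assoc)
  also have "\<dots> = (h * ((t * s) * h)) * v" by (simp add: mult.assoc)
  also have "\<dots> = h * (e * v)" using t by (simp add: mult.assoc)
  also have "\<dots> = h * v"
    using v h e Hclass_idempotent_iff[OF e] by (metis mult.assoc)
  finally have "(h * t) * s = e" using v by (simp add: mult.assoc)
  then show ?thesis using se Lclass_idempotent_iff[OF e] by blast
qed

text \<open>Finiteness supplies the right inverse: \<open>t * a = e\<close> makes left
  multiplication by \<open>a\<close> injective on the set of \<open>u\<close> with
  \<open>e * u = u\<close>, hence surjective, and \<open>e\<close> has a preimage.\<close>

lemma Hclass_of_Lclass:
  fixes e :: "'s::{semigroup_mult,finite}"
  assumes e: "e * e = e" and a: "a \<in> Lclass e" and ea: "e * a = a"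
  shows "a \<in> Hclass e"
proof -
  from a obtain t where t: "a * e = a" "t * a = e"
    using Lclass_idempotent_iff[OF e] by blast
  let ?U = "{u. e * u = u}"
  have "inj_on ((*) a) ?U"
  proof (rule inj_onI)
    fix u v assume "u \<in> ?U" "v \<in> ?U" and "a * u = a * v"
    then have "t * a * u = t * a * v" by (simp add: mult.assoc)
    then show "u = v" using \<open>u \<in> ?U\<close> \<open>v \<in> ?U\<close> t by simp
  qed
  moreover have "(*) a ` ?U \<subseteq> ?U" using ea by (auto simp flip: mult.assoc)
  ultimately have "(*) a ` ?U = ?U" by (simp add: endo_inj_surj)
  then have "e \<in> (*) a ` ?U" using e by simp
  then obtain u where "a * u = e" by auto
  then show ?thesis using t ea Hclass_idempotent_iff[OF e] by blast
qed

section \<open>Two-sided ideals and J-equivalent idempotents\<close>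

lemma ideal1_subset_iff: "ideal1 b \<subseteq> ideal1 a \<longleftrightarrow> b \<in> ideal1 a"
proof
  assume "b \<in> ideal1 a"
  then have "b = a \<or> (\<exists>s. b = s * a) \<or> (\<exists>t. b = a * t) \<or> (\<exists>s t. b = s * a * t)"
    by (auto simp: ideal1_def)
  then show "ideal1 b \<subseteq> ideal1 a"
    unfolding ideal1_def by (elim disjE exE) (simp; safe; metis mult.assoc)+
qed (auto simp: ideal1_def)

lemma ideal1_idempotentE:
  assumes "f \<in> ideal1 a" and "f * f = f"
  obtains s t where "f = s * a * t"
proof -
  have "f = a \<or> (\<exists>s. f = s * a) \<or> (\<exists>t. f = a * t) \<or> (\<exists>s t. f = s * a * t)"
    using assms(1) by (auto simp: ideal1_def)
  then have "\<exists>s t. f = s * a * t" using assms(2) by (metis mult.assoc)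
  then show ?thesis using that by blast
qed

text \<open>In a finite semigroup J-equivalent idempotents are D-equivalent. Trimming
  \<open>f = s * e * t\<close> to the corners gives \<open>x * y = f\<close> with
  \<open>y * x\<close> an idempotent below \<open>e\<close>; finiteness then forces
  \<open>y * x = e\<close>.\<close>

lemma J_equivalent_idempotentsE:
  fixes e f :: "'s::{semigroup_mult,finite}"
  assumes e: "e * e = e" and f: "f * f = f" and J: "ideal1 e = ideal1 f"
  obtains x y where "x * y = f" "y * x = e" "f * x = x" "e * y = y"
proof -
  have "f \<in> ideal1 e" "e \<in> ideal1 f" using J by (auto simp: ideal1_def)
  then obtain s t s' t' where st: "f = s * e * t" "e = s' * f * t'"
    using ideal1_idempotentE e f by metis
  define x where "x = f * s * e"
  define y where "y = e * t * f"
  define e' where "e' = y * x"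
  have xy: "x * y = f"
    unfolding x_def y_def using e f st(1) by (metis mult.assoc)
  have e'e: "e' * e = e'" "e * e' = e'"
    unfolding e'_def x_def y_def using e by (simp_all add: mult.assoc) (simp flip: mult.assoc add: e)
  have e'e': "e' * e' = e'"
    unfolding e'_def by (metis xy f mult.assoc y_def)
  have "e = s' * x * (y * x) * y * t'"
    using st(2) xy f by (metis mult.assoc)
  then have "e = (s' * x) * e' * (y * t')" by (simp add: e'_def mult.assoc)
  \<comment> \<open>These factor \<open>e\<close> through \<open>e'\<close>. Being left invertible
    in \<open>e S e\<close>, \<open>r\<close> is a unit at \<open>e\<close>; as \<open>r\<close>
    begins with \<open>e'\<close>, multiplying by its right inverse gives
    \<open>e' * e = e\<close>.\<close>
  define p where "p = e * (s' * x) * e'"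
  define r where "r = e' * (y * t') * e"
  have "p * r = e * ((s' * x) * (e' * e') * (y * t')) * e"
    unfolding p_def r_def by (simp add: mult.assoc)
  also have "\<dots> = e" using \<open>e = (s' * x) * e' * (y * t')\<close> e'e' e by simp
  finally have pr: "p * r = e" .
  have "r * e = r" "e * r = r" unfolding r_def using e e'e by (simp_all add: mult.assoc) (simp flip: mult.assoc add: e'e)
  then have "r \<in> Hclass e"
    using pr Hclass_of_Lclass[OF e] Lclass_idempotent_iff[OF e] by blast
  then obtain u where "r * u = e" using Hclass_idempotent_iff[OF e] by blast
  then have "e' * e = e"
    by (metis e'e' mult.assoc r_def)
  then have "y * x = e" using e'e e'_def by simp
  then show ?thesis
    using that xy e f unfolding x_def y_def by (metis mult.assoc)
qed

section \<open>Right restriction EI-Ehresmann semigroups\<close>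

locale Ehresmann_semigroup =
  fixes E :: "'s::semigroup_mult set"
  assumes Ehresmann: "Ehresmann E"
begin

lemma E_idem: "e \<in> E \<Longrightarrow> e * e = e"
  and E_comm: "e \<in> E \<Longrightarrow> f \<in> E \<Longrightarrow> e * f = f * e"
  using Ehresmann unfolding Ehresmann_def subsemilattice_def by blast+

lemma star_in: "star E a \<in> E" and tildeL_star: "tildeL E a (star E a)"
proof -
  have "\<exists>!e. e \<in> E \<and> tildeL E a e" using Ehresmann unfolding Ehresmann_def by blast
  from theI'[OF this] show "star E a \<in> E" "tildeL E a (star E a)"
    by (simp_all add: star_def)
qed

lemma plus_in: "plus E a \<in> E" and tildeR_plus: "tildeR E a (plus E a)"
proof -
  have "\<exists>!e. e \<in> E \<and> tildeR E a e" using Ehresmann unfolding Ehresmann_def by blast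
  from theI'[OF this] show "plus E a \<in> E" "tildeR E a (plus E a)"
    by (simp_all add: plus_def)
qed

lemma star_cong: "tildeL E a b \<Longrightarrow> star E a = star E b"
  by (simp add: star_def tildeL_def)

lemma plus_cong: "tildeR E a b \<Longrightarrow> plus E a = plus E b"
  by (simp add: plus_def tildeR_def)

lemma star_E: "e \<in> E \<Longrightarrow> star E e = e"
  unfolding star_def using Ehresmann unfolding Ehresmann_def
  by (intro the1_equality) (auto simp: tildeL_def)

lemma mult_star: "a * star E a = a"
  using tildeL_star[of a] star_in[of a] E_idem unfolding tildeL_def by blast

lemma plus_mult: "plus E a * a = a"
  using tildeR_plus[of a] plus_in[of a] E_idem unfolding tildeR_def by blast

lemma plus_mult_of_mult: "e \<in> E \<Longrightarrow> e * a = a \<Longrightarrow> e * plus E a = plus E a"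
  using tildeR_plus[of a] unfolding tildeR_def by blast

lemma star_mult_of_mult: "e \<in> E \<Longrightarrow> a * e = a \<Longrightarrow> star E a * e = star E a"
  using tildeL_star[of a] unfolding tildeL_def by blast

text \<open>The right congruence property is used in this form; \<open>plus_of_mult\<close> is the
  dual form of the left one.\<close>

lemma star_mult: "star E (a * b) = star E (star E a * b)"
  using Ehresmann tildeL_star[of a] unfolding Ehresmann_def by (meson star_cong)

lemma plus_of_mult: "plus E (a * b) = plus E (a * plus E b)"
  using Ehresmann tildeR_plus[of b] unfolding Ehresmann_def by (meson plus_cong)

end

locale right_restriction_EI =
  fixes E :: "'s::{semigroup_mult,finite} set"
  assumes right_restriction: "right_restriction E" and EI: "EI_Ehresmann E"
begin

sublocale Ehresmann_semigroup E
  using EI by unfold_locales (simp add: EI_Ehresmann_def)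

text \<open>Such an \<open>a\<close> is an endomorphism of \<open>f\<close> in C(S), so the EI
  condition inverts it. That condition enters only here; it is applied to an idempotent endomorphism
  and later to elements acting nontrivially on a module.\<close>

lemma endomorphism_in_Hclass:
  assumes "star E a = f" and "plus E a = f"
  shows "a \<in> Hclass f"
proof -
  have f: "f \<in> E" using assms star_in by blast
  have "a \<in> Hom (cat_of E) f f" using assms by (simp add: Hom_def cat_of_def)
  then have "cat_iso (cat_of E) a"
    using EI f by (auto simp: EI_Ehresmann_def EI_category_def cat_of_def)
  then obtain b where "b * a = f" "a * b = f"
    using assms by (auto simp: cat_iso_def cat_of_def)
  then show ?thesis
    using mult_star[of a] plus_mult[of a] assms Hclass_idempotent_iff[OF E_idem[OF f]] by auto
qed

text \<open>Right restriction makes \<open>e e\<^sup>+\<close> an idempotent endomorphism of \<open>e\<^sup>+\<close> in \<open>\<C>(S)\<close>.\<close>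

lemma idempotent_mult_plus:
  assumes e: "e * e = e"
  shows "e * plus E e = plus E e"
proof -
  let ?f = "star E e" and ?p = "plus E e"
  \<comment> \<open>Right restriction yields
    \<open>e\<^sup>* e = e (e\<^sup>* e)\<^sup>* = e e\<^sup>* = e\<close>, so
    \<open>e\<^sup>+\<close> lies below \<open>e\<^sup>*\<close>. This is what gives
    \<open>e * ?p\<close> the domain \<open>?p\<close>.\<close>
  have "star E (?f * e) = ?f" using star_mult[of e e] e by simp
  then have "?f * e = e"
    using right_restriction star_in[of e] mult_star[of e] unfolding right_restriction_def by metis
  then have fp: "?f * ?p = ?p" using plus_mult_of_mult star_in by blast
  have "star E (e * ?p) = ?p" using star_mult[of e ?p] fp star_E[OF plus_in] by simp
  moreover have "plus E (e * ?p) = ?p" using plus_of_mult[of e e] e by simp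
  ultimately have "e * ?p \<in> Hclass ?p" by (rule endomorphism_in_Hclass)
  then obtain h where "h * (e * ?p) = ?p"
    using Hclass_idempotent_iff[OF E_idem[OF plus_in]] by blast
  then have "h * e * ?p = ?p" by (simp add: mult.assoc)
  \<comment> \<open>An idempotent in a group is the identity: once \<open>?p\<close> is inserted
    between the two factors \<open>e\<close>, the left inverse \<open>h\<close> cancels the first of
    them.\<close>
  then have "?p = h * (e * e) * ?p" using e by simp
  also have "\<dots> = h * e * (?p * e) * ?p" by (simp add: plus_mult mult.assoc)
  also have "\<dots> = ?p * e * ?p" using \<open>h * e * ?p = ?p\<close> by (simp flip: mult.assoc)
  finally show ?thesis by (simp add: plus_mult)
qed

text \<open>If \<open>t\<close> is a left inverse of \<open>x\<close>, the idempotent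
  \<open>x * t\<close> is R-related to \<open>q = (x t)\<^sup>+\<close>. Replacing \<open>t\<close>
  by \<open>t * q\<close> moves the product \<open>x * y\<close> into \<open>E\<close> and keeps
  \<open>y * x = e\<close>.\<close>

lemma Lclass_inverseE:
  assumes e: "e * e = e" and x: "x \<in> Lclass e"
  obtains y where "x * y \<in> E" "y * x = e" "e * y = y"
proof -
  from x obtain t where t: "x * e = x" "t * x = e"
    using Lclass_idempotent_iff[OF e] by blast
  define q where "q = plus E (x * t)"
  have xt: "(x * t) * (x * t) = x * t" using t by (metis mult.assoc)
  then have q: "x * t * q = q" unfolding q_def by (rule idempotent_mult_plus)
  have "q * (x * t) = x * t" unfolding q_def by (rule plus_mult)
  then have "q * x = x" using t by (metis mult.assoc)
  then have "(t * q) * x = e" using t by (simp add: mult.assoc)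
  moreover have "x * (t * q) = q" using q by (simp add: mult.assoc)
  moreover have "e * (t * q) = t * q" using q t by (metis mult.assoc)
  moreover have "q \<in> E" unfolding q_def by (rule plus_in)
  ultimately show ?thesis using that by metis
qed

text \<open>These elements of \<open>E\<close> index the \<open>\<R>\<close>-classes inside \<open>\<L>(e)\<close>.\<close>

definition proj :: "'s \<Rightarrow> 's set" where
  "proj e = {q \<in> E. \<exists>x y. x * y = q \<and> y * x = e \<and> e * y = y \<and> x * e = x}"

text \<open>This says that a square part of the sandwich matrix of the \<open>\<J>\<close>-class is the identity
  matrix, which forces \<open>Ind\<close> to preserve simplicity.\<close>

lemma proj_separates_Lclass:
  assumes e: "e * e = e" and x': "x' \<in> Lclass e"
  obtains q where "q \<in> proj e" "q * x' = x'" "\<And>r. r \<in> proj e \<Longrightarrow> r * x' \<in> Lclass e \<Longrightarrow> r = q"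
proof -
  obtain y' where y': "x' * y' \<in> E" "y' * x' = e" "e * y' = y'"
    using Lclass_inverseE[OF e x'] by blast
  have x'e: "x' * e = x'" using x' Lclass_idempotent_iff[OF e] by blast
  define q' where "q' = x' * y'"
  have q': "q' \<in> proj e" "q' \<in> E" "q' * x' = x'"
    unfolding proj_def q'_def using y' x'e by (auto simp: mult.assoc)
  have "q = q'" if q: "q \<in> proj e" and L: "q * x' \<in> Lclass e" for q
  proof -
    obtain x y where xy: "q \<in> E" "x * y = q" "y * x = e" "e * y = y" "x * e = x"
      using q unfolding proj_def by blast
    obtain t where t: "t * (q * x') = e" using L Lclass_idempotent_iff[OF e] by blast
    \<comment> \<open>Inserting \<open>e = t * (q * x')\<close> between \<open>x'\<close> and
      \<open>y'\<close> makes \<open>q'\<close> a left multiple of \<open>q * q'\<close>; as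
      elements of \<open>E\<close> commute, \<open>q'\<close> lies below \<open>q\<close>.\<close>
    have "q' = x' * (t * (q * x')) * y'" using t x'e q'_def by simp
    also have "\<dots> = x' * t * (q * q')" by (simp add: q'_def mult.assoc)
    finally have 1: "q' = x' * t * (q * q')" .
    have "q * q' * q = q * q'"
      using E_comm[OF xy(1) q'(2)] E_idem[OF xy(1)] by (metis mult.assoc)
    then have q'q: "q' * q = q'" using 1 by (metis mult.assoc)
    then have qx': "q * x' = x'" using q'(3) E_comm[OF xy(1) q'(2)] by (metis mult.assoc)
    \<comment> \<open>For the converse, \<open>a\<close> lies in \<open>e S e\<close> and is left
      invertible there, hence a unit. Then \<open>q = x * (a * b) * y\<close> can be rewritten to
      begin with \<open>x'\<close>, which \<open>q'\<close> fixes, so \<open>q\<close> lies below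
      \<open>q'\<close>.\<close>
    define a where "a = y * x'"
    have "(t * x) * a = e" unfolding a_def using t xy(2) by (metis mult.assoc)
    moreover have ae: "a * e = a" "e * a = a"
      unfolding a_def using x'e xy(4) by (simp_all add: mult.assoc) (simp flip: mult.assoc)
    ultimately have "a \<in> Hclass e"
      using Hclass_of_Lclass[OF e] Lclass_idempotent_iff[OF e] by blast
    then obtain b where b: "a * b = e" using Hclass_idempotent_iff[OF e] by blast
    have "q = x * (a * b) * y" using xy b by simp
    also have "\<dots> = q * x' * b * y" unfolding a_def using xy(2) by (simp flip: mult.assoc)
    also have "\<dots> = x' * b * y" using qx' by simp
    finally have "q = x' * b * y" .
    then have "q' * q = q" using q'(3) by (simp flip: mult.assoc)
    then show ?thesis using q'q by simp
  qed
  then show ?thesis using that[of q'] q' by blast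
qed

end

section \<open>Convolution algebras\<close>

definition funs_on :: "'s set \<Rightarrow> ('s \<Rightarrow> 'k::zero) set" where
  "funs_on T = {f. \<forall>s. s \<notin> T \<longrightarrow> f s = 0}"

text \<open>The element \<open>k s\<close> of the semigroup algebra. The coefficient is included so
  that these elements generate the algebra under addition alone.\<close>

definition point :: "'s \<Rightarrow> 'k \<Rightarrow> 's \<Rightarrow> 'k::zero" where
  "point s k = (\<lambda>u. if u = s then k else 0)"

lemma point_in_funs_on: "s \<in> T \<Longrightarrow> point s k \<in> funs_on T"
  by (auto simp: funs_on_def point_def)

lemma point_add_minus: "(\<lambda>u. point s k u + point s (- k) u) = (\<lambda>_. 0 :: 'k::group_add)"
  by (auto simp: point_def)

lemma funs_on_zero: "(\<lambda>_. 0) \<in> funs_on T"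
  by (simp add: funs_on_def)

lemma funs_on_add: "f \<in> funs_on T \<Longrightarrow> g \<in> funs_on T \<Longrightarrow> (\<lambda>s. f s + g s :: 'k::monoid_add) \<in> funs_on T"
  by (simp add: funs_on_def)

lemma funs_on_mono: "f \<in> funs_on T \<Longrightarrow> T \<subseteq> U \<Longrightarrow> f \<in> funs_on U"
  by (auto simp: funs_on_def)

lemma funs_on_UNIV: "funs_on UNIV = UNIV"
  by (simp add: funs_on_def)

text \<open>Induction on a finite set containing the support, splitting off one value at a time.
  Additive claims about the algebra are thereby reduced to products in \<open>S\<close>.\<close>

lemma funs_on_induct [consumes 1, case_names zero point add]:
  fixes f :: "'s::finite \<Rightarrow> 'k::monoid_add"
  assumes f: "f \<in> funs_on T"
    and zero: "P (\<lambda>_. 0)"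
    and point: "\<And>s k. s \<in> T \<Longrightarrow> P (point s k)"
    and add: "\<And>f g. f \<in> funs_on T \<Longrightarrow> g \<in> funs_on T \<Longrightarrow> P f \<Longrightarrow> P g \<Longrightarrow> P (\<lambda>s. f s + g s)"
  shows "P f"
proof -
  have "P f" if "finite A" "f \<in> funs_on T" "{s. f s \<noteq> 0} \<subseteq> A" for A and f :: "'s \<Rightarrow> 'k"
    using that
  proof (induction A arbitrary: f rule: finite_induct)
    case empty
    then have "f = (\<lambda>_. 0)" by auto
    then show ?case using zero by simp
  next
    case (insert a A)
    let ?g = "\<lambda>s. if s = a then 0 else f s"
    have g: "?g \<in> funs_on T" using insert.prems by (simp add: funs_on_def)
    have Pg: "P ?g" by (rule insert.IH[OF g]) (use insert.prems in auto)
    show ?case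
    proof (cases "a \<in> T")
      case True
      have "f = (\<lambda>s. point a (f a) s + ?g s)" by (auto simp: point_def)
      then show ?thesis
        using add[OF point_in_funs_on[OF True, of "f a"] g point[OF True] Pg] by simp
    next
      case False
      then have "f = ?g" using insert.prems by (auto simp: funs_on_def)
      then show ?thesis using Pg by simp
    qed
  qed
  from this[of UNIV f] f show ?thesis by simp
qed

section \<open>Bilinearity and associativity of convolution\<close>

lemma convolution_add_left:
  "convolution (\<lambda>s. f s + g s) h = (\<lambda>s. convolution f h s + convolution g h s)"
  unfolding convolution_def by (simp add: distrib_right sum.distrib case_prod_unfold)

lemma convolution_add_right:
  "convolution f (\<lambda>s. g s + h s) = (\<lambda>s. convolution f g s + convolution f h s)"
  unfolding convolution_def by (simp add: distrib_left sum.distrib case_prod_unfold)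

lemma convolution_zero_left: "convolution (\<lambda>_. 0) f = (\<lambda>_. 0)"
  and convolution_zero_right: "convolution f (\<lambda>_. 0) = (\<lambda>_. 0)"
  unfolding convolution_def by (simp_all add: case_prod_unfold)

lemma convolution_point: "convolution (point s k) (point t l) = point (s * t) (k * l)"
proof
  fix u
  have "convolution (point s k) (point t l) u =
    (\<Sum>p | fst p * snd p = u. if p = (s, t) then k * l else 0)"
    unfolding convolution_def by (intro sum.cong) (auto simp: point_def split: if_splits)
  also have "\<dots> = point (s * t) (k * l) u" by (auto simp: point_def)
  finally show "convolution (point s k) (point t l) u = point (s * t) (k * l) u" .
qed

text \<open>Both sides are additive in each argument, so three nested inductions lead to points,
  where the claim is associativity in \<open>S\<close>.\<close>

lemma convolution_assoc: "convolution (convolution f g) h = convolution f (convolution g h)"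
proof -
  have "f \<in> funs_on UNIV" "g \<in> funs_on UNIV" "h \<in> funs_on UNIV" by (simp_all add: funs_on_UNIV)
  then show ?thesis
  proof (induction f rule: funs_on_induct)
    case (point s k)
    from point(2,3) show ?case
    proof (induction g rule: funs_on_induct)
      case (point t l)
      from point(2) show ?case
        by (induction h rule: funs_on_induct)
          (simp_all add: convolution_point convolution_add_right convolution_zero_right mult.assoc)
    qed (simp_all add: convolution_add_left convolution_add_right convolution_zero_left
        convolution_zero_right)
  qed (simp_all add: convolution_add_left convolution_zero_left)
qed

lemma convolution_in_funs_on:
  assumes "f \<in> funs_on A" and "g \<in> funs_on B"
    and AB: "\<And>s t. s \<in> A \<Longrightarrow> t \<in> B \<Longrightarrow> s * t \<in> C"
  shows "convolution f g \<in> funs_on C"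
  unfolding funs_on_def
proof (intro CollectI allI impI)
  fix u assume "u \<notin> C"
  then have "f s * g t = 0" if "s * t = u" for s t
    using that assms unfolding funs_on_def by (metis (mono_tags, lifting) mem_Collect_eq mult_eq_0_iff)
  then show "convolution f g u = 0" unfolding convolution_def by (intro sum.neutral) auto
qed

lemma convolution_scale_unit:
  assumes "convolution u f = f"
  shows "convolution (\<lambda>s. c * u s) f = (\<lambda>s. c * f s)"
proof -
  have "convolution (\<lambda>s. c * u s) f = (\<lambda>s. c * convolution u f s)"
    unfolding convolution_def by (simp add: sum_distrib_left case_prod_unfold mult.assoc)
  then show ?thesis using assms by simp
qed

section \<open>Algebras of subsemigroups and their identities\<close>

lemma carrier_semigroup_algebra: "carrier (semigroup_algebra T) = funs_on T"
  and mult_semigroup_algebra: "monoid.mult (semigroup_algebra T) = convolution"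
  and zero_semigroup_algebra: "ring.zero (semigroup_algebra T) = (\<lambda>_. 0)"
  and add_semigroup_algebra: "ring.add (semigroup_algebra T) = (\<lambda>f g s. f s + g s)"
  by (simp_all add: semigroup_algebra_def funs_on_def)

lemmas semigroup_algebra_simps =
  carrier_semigroup_algebra mult_semigroup_algebra zero_semigroup_algebra add_semigroup_algebra

text \<open>A two-sided identity is unique, so the definite description in
  \<open>semigroup_algebra\<close> denotes \<open>u\<close>.\<close>

lemma one_semigroup_algebra:
  assumes u: "u \<in> funs_on T"
    and unit: "\<And>f. f \<in> funs_on T \<Longrightarrow> convolution u f = f \<and> convolution f u = f"
  shows "one (semigroup_algebra T) = u"
proof -
  have "(THE u. u \<in> funs_on T \<and> (\<forall>f. f \<in> funs_on T \<longrightarrow> convolution u f = f \<and> convolution f u = f)) = u"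
    by (rule the_equality) (use u unit in metis)+
  then show ?thesis by (simp add: semigroup_algebra_def funs_on_def)
qed

lemma ring_semigroup_algebra:
  fixes u :: "'s::{semigroup_mult,finite} \<Rightarrow> 'k::field"
  assumes T: "\<And>s t. s \<in> T \<Longrightarrow> t \<in> T \<Longrightarrow> s * t \<in> T"
    and u: "u \<in> funs_on T"
    and unit: "\<And>f. f \<in> funs_on T \<Longrightarrow> convolution u f = f \<and> convolution f u = f"
  shows "ring (semigroup_algebra T :: ('s \<Rightarrow> 'k) ring)"
    (is "ring ?A")
proof (rule ringI)
  show "abelian_group ?A"
  proof (rule abelian_groupI)
    fix x :: "'s \<Rightarrow> 'k" assume "x \<in> carrier ?A"
    then have "(\<lambda>s. - x s) \<in> carrier ?A" "(\<lambda>s. - x s) \<oplus>\<^bsub>?A\<^esub> x = \<zero>\<^bsub>?A\<^esub>"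
      by (simp_all add: semigroup_algebra_simps funs_on_def)
    then show "\<exists>y\<in>carrier ?A. y \<oplus>\<^bsub>?A\<^esub> x = \<zero>\<^bsub>?A\<^esub>" by blast
  qed (auto simp: semigroup_algebra_simps funs_on_add funs_on_zero add.assoc add.commute)
  have one: "one ?A = u" by (rule one_semigroup_algebra[OF u unit])
  show "monoid ?A"
  proof (rule monoidI)
    show "x \<otimes>\<^bsub>?A\<^esub> y \<in> carrier ?A" if "x \<in> carrier ?A" "y \<in> carrier ?A" for x y
      using that convolution_in_funs_on[of x T y T T] T by (simp add: semigroup_algebra_simps)
  qed (use u unit in \<open>simp_all add: semigroup_algebra_simps one convolution_assoc\<close>)
qed (simp_all add: semigroup_algebra_simps convolution_add_left convolution_add_right)

lemma group_algebra_unit: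
  fixes e :: "'s::{semigroup_mult,finite}" and f :: "'s \<Rightarrow> 'k::field"
  assumes e: "e * e = e" and f: "f \<in> funs_on (Hclass e)"
  shows "convolution (point e 1) f = f \<and> convolution f (point e 1) = f"
  using f
proof (induction rule: funs_on_induct)
  case (point s k)
  then have "e * s = s" "s * e = s" using Hclass_idempotent_iff[OF e] by blast+
  then show ?case by (simp add: convolution_point)
qed (simp_all add: convolution_zero_right convolution_zero_left convolution_add_right
    convolution_add_left)

lemma one_group_algebra:
  "e * e = e \<Longrightarrow> one (semigroup_algebra (Hclass e)) = (point e 1 :: _ \<Rightarrow> 'k::field)"
  by (intro one_semigroup_algebra point_in_funs_on Hclass_self group_algebra_unit)

lemma ring_group_algebra:
  assumes "e * e = e"
  shows "ring (semigroup_algebra (Hclass e) :: ('s::{semigroup_mult,finite} \<Rightarrow> 'k::field) ring)"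
  by (rule ring_semigroup_algebra[OF Hclass_mult_closed[OF assms] point_in_funs_on[OF Hclass_self]
        group_algebra_unit[OF assms]])

context right_restriction_EI
begin

text \<open>The identity of the algebra of the semilattice \<open>E\<close> is built by
  \<open>1 - (1 - e\<^sub>1) \<cdots> (1 - e\<^sub>n)\<close>; it is an identity for \<open>S\<close> because \<open>a\<^sup>+ a = a = a a\<^sup>*\<close>.\<close>

lemma ex_semilattice_left_unit:
  assumes "finite F" and "F \<subseteq> E"
  shows "\<exists>u :: 's \<Rightarrow> 'k::field. \<forall>e\<in>F. convolution u (point e 1) = point e 1"
  using assms
proof (induction rule: finite_induct)
  case (insert f F)
  then obtain u :: "'s \<Rightarrow> 'k" where u: "\<forall>e\<in>F. convolution u (point e 1) = point e 1" by auto
  \<comment> \<open>This is \<open>u + f - u f\<close>, that is \<open>1 - (1 - u) (1 - f)\<close>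
    multiplied out. Commutativity of \<open>E\<close> keeps it a left identity for the earlier
    elements.\<close>
  let ?v = "\<lambda>s. u s + (point f 1 s + convolution u (point f (- 1)) s)"
  have neg: "(\<lambda>s. convolution u (point e 1) s + convolution u (point e (- 1)) s) = (\<lambda>_. 0)" for e
    by (subst convolution_add_right[symmetric]) (simp add: point_add_minus convolution_zero_right)
  have "convolution ?v (point e 1) = point e 1" if e: "e \<in> F" for e
  proof -
    have fe: "f * e = e * f" using E_comm insert.prems e by blast
    have "convolution (convolution u (point f (- 1))) (point e 1) =
      convolution (convolution u (point e 1)) (point f (- 1))"
      by (simp add: convolution_assoc convolution_point fe)
    then show ?thesis
      using u e by (simp add: convolution_add_left convolution_point fe) (auto simp: point_def)
  qed
  moreover have "convolution ?v (point f 1) = point f 1"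
  proof -
    have "f * f = f" using E_idem insert.prems by blast
    then show ?thesis
      using fun_cong[OF neg[of f]]
      by (auto simp: convolution_add_left convolution_assoc convolution_point algebra_simps)
  qed
  ultimately show ?case by (intro exI[of _ ?v]) simp
qed simp

text \<open>The mirror image, with \<open>u + f - f u\<close>. The left and right identities are
  constructed separately and coincide once both extend to \<open>S\<close>.\<close>

lemma ex_semilattice_right_unit:
  assumes "finite F" and "F \<subseteq> E"
  shows "\<exists>u :: 's \<Rightarrow> 'k::field. \<forall>e\<in>F. convolution (point e 1) u = point e 1"
  using assms
proof (induction rule: finite_induct)
  case (insert f F)
  then obtain u :: "'s \<Rightarrow> 'k" where u: "\<forall>e\<in>F. convolution (point e 1) u = point e 1" by auto
  let ?v = "\<lambda>s. u s + (point f 1 s + convolution (point f (- 1)) u s)"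
  have neg: "(\<lambda>s. convolution (point e 1) u s + convolution (point e (- 1)) u s) = (\<lambda>_. 0)" for e
    by (subst convolution_add_left[symmetric]) (simp add: point_add_minus convolution_zero_left)
  have "convolution (point e 1) ?v = point e 1" if e: "e \<in> F" for e
  proof -
    have fe: "f * e = e * f" using E_comm insert.prems e by blast
    have "convolution (point e 1) (convolution (point f (- 1)) u) =
      convolution (point f (- 1)) (convolution (point e 1) u)"
      by (simp add: convolution_point fe flip: convolution_assoc)
    then show ?thesis
      using u e by (simp add: convolution_add_right convolution_point fe) (auto simp: point_def)
  qed
  moreover have "convolution (point f 1) ?v = point f 1"
  proof -
    have "f * f = f" using E_idem insert.prems by blast
    then show ?thesis
      using fun_cong[OF neg[of f]]
      by (auto simp: convolution_add_right convolution_point algebra_simps simp flip: convolution_assoc)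
  qed
  ultimately show ?case by (intro exI[of _ ?v]) simp
qed simp

lemma ex_unit: "\<exists>u :: 's \<Rightarrow> 'k::field. \<forall>f. convolution u f = f \<and> convolution f u = f"
proof -
  obtain u v :: "'s \<Rightarrow> 'k"
    where u: "\<And>e. e \<in> E \<Longrightarrow> convolution u (point e 1) = point e 1"
      and v: "\<And>e. e \<in> E \<Longrightarrow> convolution (point e 1) v = point e 1"
    using ex_semilattice_left_unit[of E] ex_semilattice_right_unit[of E] by auto
  have left: "convolution u f = f" and right: "convolution f v = f" for f :: "'s \<Rightarrow> 'k"
  proof -
    have "f \<in> funs_on UNIV" by (simp add: funs_on_UNIV)
    then have "convolution u f = f \<and> convolution f v = f"
    proof (induction f rule: funs_on_induct)
      case (point s k)
      have "point s k = convolution (point (plus E s) 1) (point s k)"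
        "point s k = convolution (point s k) (point (star E s) 1)"
        by (simp_all add: convolution_point plus_mult mult_star)
      then show ?case using u[OF plus_in] v[OF star_in] convolution_assoc by metis
    qed (simp_all add: convolution_zero_right convolution_zero_left convolution_add_right
        convolution_add_left)
    then show "convolution u f = f" "convolution f v = f" by simp_all
  qed
  then have "u = v" by metis
  then show ?thesis using left right by blast
qed

lemma ring_algebra: "ring (semigroup_algebra UNIV :: ('s \<Rightarrow> 'k::field) ring)"
proof -
  obtain u :: "'s \<Rightarrow> 'k" where "\<forall>f. convolution u f = f \<and> convolution f u = f"
    using ex_unit by blast
  then show ?thesis by (intro ring_semigroup_algebra[of _ u]) (auto simp: funs_on_UNIV)
qed

lemma algebra_unit:
  fixes f :: "'s \<Rightarrow> 'k::field"
  shows "convolution (one (semigroup_algebra UNIV)) f = f"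
  using monoid.l_one[OF ring.is_monoid[OF ring_algebra], of f]
  by (simp add: semigroup_algebra_simps funs_on_UNIV)

end

section \<open>Left modules\<close>

context left_module
begin

lemma smult_zero_left: "x \<in> carrier M \<Longrightarrow> \<zero>\<^bsub>R\<^esub> \<odot>\<^bsub>M\<^esub> x = \<zero>\<^bsub>M\<^esub>"
  using smult_l_distr[of "\<zero>\<^bsub>R\<^esub>" "\<zero>\<^bsub>R\<^esub>" x] smult_closed[of "\<zero>\<^bsub>R\<^esub>" x]
  by (metis M.add.r_cancel_one' R.add.one_closed R.add.l_one)

lemma smult_zero_right: "a \<in> carrier R \<Longrightarrow> a \<odot>\<^bsub>M\<^esub> \<zero>\<^bsub>M\<^esub> = \<zero>\<^bsub>M\<^esub>"
  using smult_r_distr[of a "\<zero>\<^bsub>M\<^esub>" "\<zero>\<^bsub>M\<^esub>"] smult_closed[of a "\<zero>\<^bsub>M\<^esub>"]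
  by (metis M.add.r_cancel_one' M.add.one_closed M.add.l_one)

lemma smult_minus_left:
  assumes "a \<in> carrier R" and "x \<in> carrier M"
  shows "(\<ominus>\<^bsub>R\<^esub> a) \<odot>\<^bsub>M\<^esub> x = \<ominus>\<^bsub>M\<^esub> (a \<odot>\<^bsub>M\<^esub> x)"
proof -
  have "(\<ominus>\<^bsub>R\<^esub> a) \<odot>\<^bsub>M\<^esub> x \<oplus>\<^bsub>M\<^esub> a \<odot>\<^bsub>M\<^esub> x = \<zero>\<^bsub>M\<^esub>"
    using assms smult_l_distr[of "\<ominus>\<^bsub>R\<^esub> a" a x] by (simp add: R.l_neg smult_zero_left)
  then show ?thesis using assms by (simp add: M.minus_equality smult_closed)
qed

text \<open>Negatives come from the scalar \<open>- 1\<close>, so closure under addition and scalars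
  suffices.\<close>

lemma submoduleI:
  assumes "N \<subseteq> carrier M" and "N \<noteq> {}"
    and add: "\<And>x y. x \<in> N \<Longrightarrow> y \<in> N \<Longrightarrow> x \<oplus>\<^bsub>M\<^esub> y \<in> N"
    and smult: "\<And>a x. a \<in> carrier R \<Longrightarrow> x \<in> N \<Longrightarrow> a \<odot>\<^bsub>M\<^esub> x \<in> N"
  shows "submodule N R M"
proof -
  have "\<ominus>\<^bsub>M\<^esub> x \<in> N" if "x \<in> N" for x
    using that assms(1) smult[of "\<ominus>\<^bsub>R\<^esub> \<one>\<^bsub>R\<^esub>" x] smult_minus_left[of "\<one>\<^bsub>R\<^esub>" x] smult_one[of x]
    by auto
  then have "subgroup N (add_monoid M)"
    using assms(1,2) add by (intro M.add.subgroupI) auto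
  then show ?thesis
    using smult by (simp add: submodule_def submodule_axioms_def)
qed

lemma cyclic_submodule:
  assumes m: "m \<in> carrier M"
  shows "submodule {a \<odot>\<^bsub>M\<^esub> m |a. a \<in> carrier R} R M"
proof (rule submoduleI)
  fix x y assume "x \<in> {a \<odot>\<^bsub>M\<^esub> m |a. a \<in> carrier R}" "y \<in> {a \<odot>\<^bsub>M\<^esub> m |a. a \<in> carrier R}"
  then show "x \<oplus>\<^bsub>M\<^esub> y \<in> {a \<odot>\<^bsub>M\<^esub> m |a. a \<in> carrier R}"
    using m by clarify (metis smult_l_distr R.add.m_closed)
next
  fix b x assume "b \<in> carrier R" "x \<in> {a \<odot>\<^bsub>M\<^esub> m |a. a \<in> carrier R}"
  then show "b \<odot>\<^bsub>M\<^esub> x \<in> {a \<odot>\<^bsub>M\<^esub> m |a. a \<in> carrier R}"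
    using m by clarify (metis smult_assoc R.m_closed)
next
  show "{a \<odot>\<^bsub>M\<^esub> m |a. a \<in> carrier R} \<noteq> {}" using R.one_closed by blast
  show "{a \<odot>\<^bsub>M\<^esub> m |a. a \<in> carrier R} \<subseteq> carrier M" using m smult_closed by blast
qed

lemma cyclic_eq_carrier:
  assumes simple: "\<And>N. submodule N R M \<Longrightarrow> N = {\<zero>\<^bsub>M\<^esub>} \<or> N = carrier M"
    and m: "m \<in> carrier M" "m \<noteq> \<zero>\<^bsub>M\<^esub>" and x: "x \<in> carrier M"
  obtains a where "a \<in> carrier R" "x = a \<odot>\<^bsub>M\<^esub> m"
proof -
  have "m \<in> {a \<odot>\<^bsub>M\<^esub> m |a. a \<in> carrier R}" 
    using smult_one[OF m(1), symmetric] R.one_closed by (intro CollectI exI[of _ "\<one>\<^bsub>R\<^esub>"] conjI)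
  then have "{a \<odot>\<^bsub>M\<^esub> m |a. a \<in> carrier R} = carrier M"
    using simple[OF cyclic_submodule[OF m(1)]] m(2) by blast
  then show ?thesis using x that by blast
qed

end

lemma left_moduleI:
  assumes "ring R" and "abelian_group M"
    and "\<And>a x. a \<in> carrier R \<Longrightarrow> x \<in> carrier M \<Longrightarrow> a \<odot>\<^bsub>M\<^esub> x \<in> carrier M"
    and "\<And>a b x. a \<in> carrier R \<Longrightarrow> b \<in> carrier R \<Longrightarrow> x \<in> carrier M \<Longrightarrow>
      (a \<oplus>\<^bsub>R\<^esub> b) \<odot>\<^bsub>M\<^esub> x = a \<odot>\<^bsub>M\<^esub> x \<oplus>\<^bsub>M\<^esub> b \<odot>\<^bsub>M\<^esub> x"
    and "\<And>a x y. a \<in> carrier R \<Longrightarrow> x \<in> carrier M \<Longrightarrow> y \<in> carrier M \<Longrightarrow>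
      a \<odot>\<^bsub>M\<^esub> (x \<oplus>\<^bsub>M\<^esub> y) = a \<odot>\<^bsub>M\<^esub> x \<oplus>\<^bsub>M\<^esub> a \<odot>\<^bsub>M\<^esub> y"
    and "\<And>a b x. a \<in> carrier R \<Longrightarrow> b \<in> carrier R \<Longrightarrow> x \<in> carrier M \<Longrightarrow>
      (a \<otimes>\<^bsub>R\<^esub> b) \<odot>\<^bsub>M\<^esub> x = a \<odot>\<^bsub>M\<^esub> (b \<odot>\<^bsub>M\<^esub> x)"
    and "\<And>x. x \<in> carrier M \<Longrightarrow> \<one>\<^bsub>R\<^esub> \<odot>\<^bsub>M\<^esub> x = x"
  shows "left_module R M"
  using assms by (simp add: left_module_def left_module_axioms_def)

lemma submoduleD:
  assumes "submodule N R M"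
  shows "N \<subseteq> carrier M" "\<zero>\<^bsub>M\<^esub> \<in> N"
    and "x \<in> N \<Longrightarrow> y \<in> N \<Longrightarrow> x \<oplus>\<^bsub>M\<^esub> y \<in> N"
    and "a \<in> carrier R \<Longrightarrow> x \<in> N \<Longrightarrow> a \<odot>\<^bsub>M\<^esub> x \<in> N"
  using assms subgroup.subset[of N "add_monoid M"] subgroup.one_closed[of N "add_monoid M"]
    subgroup.m_closed[of N "add_monoid M"]
  by (auto simp: submodule_def submodule_axioms_def)

lemma additive_zero:
  assumes "abelian_group M" and "abelian_group N"
    and "\<And>x. x \<in> carrier M \<Longrightarrow> h x \<in> carrier N"
    and "\<And>x y. x \<in> carrier M \<Longrightarrow> y \<in> carrier M \<Longrightarrow> h (x \<oplus>\<^bsub>M\<^esub> y) = h x \<oplus>\<^bsub>N\<^esub> h y"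
  shows "h \<zero>\<^bsub>M\<^esub> = \<zero>\<^bsub>N\<^esub>"
proof -
  interpret M: abelian_group M by fact
  interpret N: abelian_group N by fact
  show ?thesis using assms(3,4)[of "\<zero>\<^bsub>M\<^esub>"] by (metis M.zero_closed M.l_zero N.add.r_cancel_one')
qed

lemma additive_inj_on:
  assumes M: "abelian_group M" and N: "abelian_group N"
    and h: "\<And>x. x \<in> carrier M \<Longrightarrow> h x \<in> carrier N"
    and add: "\<And>x y. x \<in> carrier M \<Longrightarrow> y \<in> carrier M \<Longrightarrow> h (x \<oplus>\<^bsub>M\<^esub> y) = h x \<oplus>\<^bsub>N\<^esub> h y"
    and ker: "\<And>x. x \<in> carrier M \<Longrightarrow> h x = \<zero>\<^bsub>N\<^esub> \<Longrightarrow> x = \<zero>\<^bsub>M\<^esub>"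
  shows "inj_on h (carrier M)"
proof (rule inj_onI)
  interpret M: abelian_group M by fact
  interpret N: abelian_group N by fact
  fix x y assume xy: "x \<in> carrier M" "y \<in> carrier M" "h x = h y"
  have "h (x \<oplus>\<^bsub>M\<^esub> \<ominus>\<^bsub>M\<^esub> y) = h (y \<oplus>\<^bsub>M\<^esub> \<ominus>\<^bsub>M\<^esub> y)"
    using xy by (simp add: add)
  also have "\<dots> = \<zero>\<^bsub>N\<^esub>" using xy additive_zero[OF M N h add] by (simp add: M.r_neg)
  finally have "x \<oplus>\<^bsub>M\<^esub> \<ominus>\<^bsub>M\<^esub> y = \<zero>\<^bsub>M\<^esub>" using ker xy by simp
  then show "x = y" using xy by (metis M.add.inv_closed M.add.inv_equality M.minus_minus)
qed

text \<open>Kernel and image are submodules; the vector \<open>x\<^sub>0\<close> makes the kernel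
  proper and the image nonzero, and simplicity of both modules decides the rest.\<close>

lemma schur:
  assumes M: "simple_module R M" and N: "simple_module R N"
    and h: "\<And>x. x \<in> carrier M \<Longrightarrow> h x \<in> carrier N"
    and add: "\<And>x y. x \<in> carrier M \<Longrightarrow> y \<in> carrier M \<Longrightarrow> h (x \<oplus>\<^bsub>M\<^esub> y) = h x \<oplus>\<^bsub>N\<^esub> h y"
    and lin: "\<And>a x. a \<in> carrier R \<Longrightarrow> x \<in> carrier M \<Longrightarrow> h (a \<odot>\<^bsub>M\<^esub> x) = a \<odot>\<^bsub>N\<^esub> h x"
    and nz: "x\<^sub>0 \<in> carrier M" "h x\<^sub>0 \<noteq> \<zero>\<^bsub>N\<^esub>"
  shows "bij_betw h (carrier M) (carrier N)"
proof -
  interpret M: left_module R M using M by (simp add: simple_module_def)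
  interpret N: left_module R N using N by (simp add: simple_module_def)
  have h0: "h \<zero>\<^bsub>M\<^esub> = \<zero>\<^bsub>N\<^esub>"
    using additive_zero[OF M.M.abelian_group_axioms N.M.abelian_group_axioms h add] .
  have "submodule {x \<in> carrier M. h x = \<zero>\<^bsub>N\<^esub>} R M"
    by (rule M.submoduleI)
      (use h0 add lin M.smult_closed N.smult_zero_right in auto)
  then have "{x \<in> carrier M. h x = \<zero>\<^bsub>N\<^esub>} = {\<zero>\<^bsub>M\<^esub>}"
    using M nz unfolding simple_module_def by blast
  then have "inj_on h (carrier M)"
    by (intro additive_inj_on[OF M.M.abelian_group_axioms N.M.abelian_group_axioms h add]) blast+
  moreover have "submodule (h ` carrier M) R N"
  proof (rule N.submoduleI)
    show "x \<oplus>\<^bsub>N\<^esub> y \<in> h ` carrier M" if "x \<in> h ` carrier M" "y \<in> h ` carrier M" for x y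
      using that by clarify (metis add imageI M.M.add.m_closed)
    show "a \<odot>\<^bsub>N\<^esub> x \<in> h ` carrier M" if "a \<in> carrier R" "x \<in> h ` carrier M" for a x
      using that by clarify (metis lin imageI M.smult_closed)
  qed (use h M.M.zero_closed in auto)
  then have "h ` carrier M = carrier N"
    using N nz unfolding simple_module_def by blast
  ultimately show ?thesis by (simp add: bij_betw_def)
qed

lemma module_isomorphic_sym:
  assumes M: "left_module R M" and iso: "module_isomorphic R M N"
  shows "module_isomorphic R N M"
proof -
  interpret M: left_module R M by fact
  obtain h where bij: "bij_betw h (carrier M) (carrier N)"
    and add: "\<And>x y. x \<in> carrier M \<Longrightarrow> y \<in> carrier M \<Longrightarrow> h (x \<oplus>\<^bsub>M\<^esub> y) = h x \<oplus>\<^bsub>N\<^esub> h y"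
    and lin: "\<And>a x. a \<in> carrier R \<Longrightarrow> x \<in> carrier M \<Longrightarrow> h (a \<odot>\<^bsub>M\<^esub> x) = a \<odot>\<^bsub>N\<^esub> h x"
    using iso unfolding module_isomorphic_def by blast
  let ?g = "inv_into (carrier M) h"
  have g: "bij_betw ?g (carrier N) (carrier M)" by (rule bij_betw_inv_into[OF bij])
  have gh: "?g (h x) = x" if "x \<in> carrier M" for x
    using bij that by (simp add: bij_betw_inv_into_left)
  have hg: "h (?g y) = y" "?g y \<in> carrier M" if "y \<in> carrier N" for y
    using bij that bij_betwE[OF g] by (simp_all add: bij_betw_inv_into_right)
  have "?g (x \<oplus>\<^bsub>N\<^esub> y) = ?g x \<oplus>\<^bsub>M\<^esub> ?g y" if "x \<in> carrier N" "y \<in> carrier N" for x y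
    using add[of "?g x" "?g y"] gh[of "?g x \<oplus>\<^bsub>M\<^esub> ?g y"] hg that by simp
  moreover have "?g (a \<odot>\<^bsub>N\<^esub> x) = a \<odot>\<^bsub>M\<^esub> ?g x" if "a \<in> carrier R" "x \<in> carrier N" for a x
    using lin[of a "?g x"] gh[of "a \<odot>\<^bsub>M\<^esub> ?g x"] M.smult_closed[of a "?g x"] hg that by simp
  ultimately show ?thesis using g unfolding module_isomorphic_def by blast
qed

text \<open>Finite dimension is automatic: a module without proper submodules is cyclic.\<close>

lemma simple_moduleI:
  fixes M :: "('s::{semigroup_mult,finite} \<Rightarrow> 'k::field, 'v) module"
  assumes M: "left_module (semigroup_algebra T) M"
    and nz: "carrier M \<noteq> {\<zero>\<^bsub>M\<^esub>}"
    and simple: "\<And>N. submodule N (semigroup_algebra T) M \<Longrightarrow> N = {\<zero>\<^bsub>M\<^esub>} \<or> N = carrier M"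
  shows "simple_module (semigroup_algebra T) M"
proof -
  let ?A = "semigroup_algebra T :: ('s \<Rightarrow> 'k) ring"
  interpret M: left_module ?A M by fact
  \<comment> \<open>The scalar \<open>c\<close> as an element of the algebra, in the form in which
    \<open>findim\<close> writes its coefficients.\<close>
  define sc where "sc = (\<lambda>c s. c * one ?A s :: 'k)"
  have one: "one ?A \<in> funs_on T"
    using M.R.one_closed by (simp add: semigroup_algebra_simps)
  have sc: "sc c \<in> carrier ?A" for c
    using one unfolding sc_def by (simp add: semigroup_algebra_simps funs_on_def)
  have sc0: "sc 0 = \<zero>\<^bsub>?A\<^esub>" unfolding sc_def by (simp add: semigroup_algebra_simps)
  have sc_add: "sc (c + d) = sc c \<oplus>\<^bsub>?A\<^esub> sc d" for c d
    unfolding sc_def by (simp add: semigroup_algebra_simps distrib_right)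
  have sc_point: "sc c \<otimes>\<^bsub>?A\<^esub> point s 1 = point s c" if "s \<in> T" for c s
  proof -
    have "convolution (one ?A) (point s 1) = (point s 1 :: 's \<Rightarrow> 'k)"
      using M.R.l_one[of "point s 1"] that by (simp add: semigroup_algebra_simps point_in_funs_on)
    from convolution_scale_unit[OF this] show ?thesis
      unfolding sc_def by (auto simp: semigroup_algebra_simps point_def)
  qed
  obtain m where m: "m \<in> carrier M" "m \<noteq> \<zero>\<^bsub>M\<^esub>" using nz M.M.zero_closed by blast
  \<comment> \<open>The translates of a generator \<open>m\<close> of the cyclic module. Translates
    by different \<open>s\<close> may coincide; since coefficients are attached to vectors, closure
    of \<open>P\<close> under sums takes care of this.\<close>
  define B where "B = (\<lambda>s. point s 1 \<odot>\<^bsub>M\<^esub> m) ` T"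
  have B: "finite B" "B \<subseteq> carrier M"
    unfolding B_def using m by (auto intro!: M.smult_closed simp: semigroup_algebra_simps point_in_funs_on)
  have smult_B: "sc (c b) \<odot>\<^bsub>M\<^esub> b \<in> carrier M" if "b \<in> B" for c b
    using that B sc M.smult_closed by blast
  define P where "P = (\<lambda>x. \<exists>c. x = (\<Oplus>\<^bsub>M\<^esub>b\<in>B. sc (c b) \<odot>\<^bsub>M\<^esub> b))"
  have P_add: "P (x \<oplus>\<^bsub>M\<^esub> y)" if xy: "P x" "P y" for x y
  proof -
    obtain c d where cd: "x = (\<Oplus>\<^bsub>M\<^esub>b\<in>B. sc (c b) \<odot>\<^bsub>M\<^esub> b)" "y = (\<Oplus>\<^bsub>M\<^esub>b\<in>B. sc (d b) \<odot>\<^bsub>M\<^esub> b)"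
      using xy unfolding P_def by blast
    have "x \<oplus>\<^bsub>M\<^esub> y = (\<Oplus>\<^bsub>M\<^esub>b\<in>B. sc (c b) \<odot>\<^bsub>M\<^esub> b \<oplus>\<^bsub>M\<^esub> sc (d b) \<odot>\<^bsub>M\<^esub> b)"
      unfolding cd by (rule M.M.finsum_addf[symmetric]) (use smult_B in auto)
    also have "\<dots> = (\<Oplus>\<^bsub>M\<^esub>b\<in>B. sc (c b + d b) \<odot>\<^bsub>M\<^esub> b)"
      by (rule M.M.finsum_cong')
        (use B smult_B sc in \<open>auto simp: sc_add M.smult_l_distr subset_iff\<close>)
    finally show ?thesis unfolding P_def by (intro exI[of _ "\<lambda>b. c b + d b"])
  qed
  have P_scale: "P (sc k \<odot>\<^bsub>M\<^esub> b)" if b: "b \<in> B" for k b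
  proof -
    let ?c = "\<lambda>b'. if b' = b then k else 0"
    have "(\<Oplus>\<^bsub>M\<^esub>b'\<in>B. sc (?c b') \<odot>\<^bsub>M\<^esub> b') = (\<Oplus>\<^bsub>M\<^esub>b'\<in>B. if b = b' then sc k \<odot>\<^bsub>M\<^esub> b' else \<zero>\<^bsub>M\<^esub>)"
      by (rule M.M.finsum_cong') (use B smult_B[of _ "\<lambda>_. k"] in \<open>auto simp: sc0 M.smult_zero_left subset_iff\<close>)
    also have "\<dots> = sc k \<odot>\<^bsub>M\<^esub> b"
      by (rule M.M.finsum_singleton) (use b B smult_B[of _ "\<lambda>_. k"] in auto)
    finally show ?thesis unfolding P_def by (intro exI[of _ ?c]) simp
  qed
  have "P (a \<odot>\<^bsub>M\<^esub> m)" if "a \<in> funs_on T" for a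
    using that
  proof (induction a rule: funs_on_induct)
    case zero
    have "(\<lambda>_. 0) \<odot>\<^bsub>M\<^esub> m = \<zero>\<^bsub>M\<^esub>"
      using M.smult_zero_left[OF m(1)] by (simp add: semigroup_algebra_simps)
    moreover have "P \<zero>\<^bsub>M\<^esub>"
    proof -
      have "(\<Oplus>\<^bsub>M\<^esub>b\<in>B. sc 0 \<odot>\<^bsub>M\<^esub> b) = (\<Oplus>\<^bsub>M\<^esub>b\<in>B. \<zero>\<^bsub>M\<^esub>)"
        by (rule M.M.finsum_cong')
          (use B in \<open>auto simp: sc0 M.smult_zero_left subset_iff\<close>)
      then show ?thesis unfolding P_def by (intro exI[of _ "\<lambda>_. 0"]) (simp add: M.M.finsum_zero)
    qed
    ultimately show ?case by simp
  next
    case (point s k)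
    have "point s k \<odot>\<^bsub>M\<^esub> m = sc k \<odot>\<^bsub>M\<^esub> (point s 1 \<odot>\<^bsub>M\<^esub> m)"
      using M.smult_assoc[OF sc _ m(1), of "point s 1" k] point
      by (simp add: sc_point semigroup_algebra_simps(1) point_in_funs_on)
    moreover have "point s 1 \<odot>\<^bsub>M\<^esub> m \<in> B" unfolding B_def using point by blast
    ultimately show ?case using P_scale by simp
  next
    case (add f g)
    then show ?case
      using M.smult_l_distr[of f g m] m(1) P_add by (simp add: semigroup_algebra_simps)
  qed
  then have "P x" if "x \<in> carrier M" for x
    using M.cyclic_eq_carrier[OF simple m that] by (metis carrier_semigroup_algebra)
  then have "findim ?A M"
    unfolding findim_def P_def sc_def using B by (intro exI[of _ B]) auto
  then show ?thesis using M nz simple unfolding simple_module_def by blast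
qed

section \<open>Tensor products\<close>

locale bimodule_tensor = X?: left_module A X + V?: abelian_group V
  for A and R :: "('b, 'c) ring_scheme" and X :: "('a, 'b, 'm) bimodule" and V :: "('b, 'v) module" +
  assumes rsmult_closed: "x \<in> carrier X \<Longrightarrow> r \<in> carrier R \<Longrightarrow> rsmult X x r \<in> carrier X"
    and smult_rsmult: "a \<in> carrier A \<Longrightarrow> x \<in> carrier X \<Longrightarrow> r \<in> carrier R \<Longrightarrow>
      a \<odot>\<^bsub>X\<^esub> rsmult X x r = rsmult X (a \<odot>\<^bsub>X\<^esub> x) r"
    and V_smult_closed: "r \<in> carrier R \<Longrightarrow> v \<in> carrier V \<Longrightarrow> r \<odot>\<^bsub>V\<^esub> v \<in> carrier V"
begin

abbreviation "F \<equiv> free_Abelian_group (carrier X \<times> carrier V)"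
abbreviation "K \<equiv> generate F (tensor_relations R X V)"
abbreviation "T \<equiv> tensor_product R X V"

section \<open>The quotient by the tensor relations\<close>

definition coset_of :: "('m \<times> 'v \<Rightarrow>\<^sub>0 int) \<Rightarrow> ('m \<times> 'v \<Rightarrow>\<^sub>0 int) set" where
  "coset_of c = K #>\<^bsub>F\<^esub> c"

definition tens :: "'m \<Rightarrow> 'v \<Rightarrow> ('m \<times> 'v \<Rightarrow>\<^sub>0 int) set" where
  "tens x v = coset_of (frag_of (x, v))"

text \<open>The action on representatives: \<open>tensor_product\<close> defines the action on a
  coset through this endomorphism of the free abelian group.\<close>

definition left_act :: "'a \<Rightarrow> ('m \<times> 'v \<Rightarrow>\<^sub>0 int) \<Rightarrow> 'm \<times> 'v \<Rightarrow>\<^sub>0 int" where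
  "left_act a = frag_extend (\<lambda>(x, v). frag_of (a \<odot>\<^bsub>X\<^esub> x, v))"

lemma keys_diff_subset: "Poly_Mapping.keys c \<subseteq> S \<Longrightarrow> Poly_Mapping.keys d \<subseteq> S \<Longrightarrow>
    Poly_Mapping.keys (c - d :: _ \<Rightarrow>\<^sub>0 int) \<subseteq> S"
  using keys_diff[of c d] by blast

lemma keys_add_subset: "Poly_Mapping.keys c \<subseteq> S \<Longrightarrow> Poly_Mapping.keys d \<subseteq> S \<Longrightarrow>
    Poly_Mapping.keys (c + d :: _ \<Rightarrow>\<^sub>0 int) \<subseteq> S"
  using Poly_Mapping.keys_add[of c d] by blast

lemma tensor_relations_subset: "tensor_relations R X V \<subseteq> carrier F"
  unfolding tensor_relations_def
  by (auto dest!: subsetD[OF keys_diff] simp: V_smult_closed rsmult_closed)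

lemma K_subgroup: "subgroup K F"
  by (rule group.generate_is_subgroup[OF group_free_Abelian_group tensor_relations_subset])

lemma K_normal: "K \<lhd> F"
  by (rule comm_group.subgroup_imp_normal[OF abelian_free_Abelian_group K_subgroup])

lemma K_zero: "0 \<in> K"
  using generate.one[of F] by simp

lemma K_carrier: "k \<in> K \<Longrightarrow> Poly_Mapping.keys k \<subseteq> carrier X \<times> carrier V"
  using subgroup.mem_carrier[OF K_subgroup] by simp

lemma K_add: "k \<in> K \<Longrightarrow> l \<in> K \<Longrightarrow> k + l \<in> K"
  using generate.eng[of k F _ l] by simp

lemma K_uminus: "k \<in> K \<Longrightarrow> - k \<in> K"
  using subgroup.m_inv_closed[OF K_subgroup, of k] K_carrier[of k] by simp

lemma K_diff: "k \<in> K \<Longrightarrow> l \<in> K \<Longrightarrow> k - l \<in> K"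
  using K_add[of k "- l"] K_uminus by simp

lemma K_rel: "k \<in> tensor_relations R X V \<Longrightarrow> k \<in> K"
  by (rule generate.incl)

lemma coset_of_eq: "coset_of c = (\<lambda>k. k + c) ` K"
  by (auto simp: coset_of_def r_coset_def)

lemma coset_of_eq_iff: "coset_of c = coset_of d \<longleftrightarrow> c - d \<in> K"
proof
  assume "coset_of c = coset_of d"
  then have "c \<in> coset_of d" unfolding coset_of_eq[of c] using K_zero by force
  then show "c - d \<in> K" by (auto simp: coset_of_eq)
next
  have sub: "coset_of c \<subseteq> coset_of d" if cd: "c - d \<in> K" for c d
  proof
    fix x assume "x \<in> coset_of c"
    then obtain k where k: "k \<in> K" "x = k + c" by (auto simp: coset_of_eq)
    then have "x = (k + (c - d)) + d" by simp
    then show "x \<in> coset_of d" using K_add[OF k(1) cd] unfolding coset_of_eq by (rule image_eqI)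
  qed
  assume cd: "c - d \<in> K"
  then show "coset_of c = coset_of d" using sub[OF cd] sub[of d c] K_uminus[OF cd] by simp
qed

lemma carrier_T: "carrier T = coset_of ` carrier F"
  by (simp add: tensor_product_def Let_def carrier_FactGroup coset_of_def)

lemma zero_T: "\<zero>\<^bsub>T\<^esub> = coset_of 0"
  by (simp add: tensor_product_def Let_def coset_of_eq)

lemma add_T:
  assumes "c \<in> carrier F" and "d \<in> carrier F"
  shows "coset_of c \<oplus>\<^bsub>T\<^esub> coset_of d = coset_of (c + d)"
  using normal.rcos_sum[OF K_normal assms] by (simp add: tensor_product_def Let_def coset_of_def)

lemma abelian_group_T: "abelian_group T"
proof -
  interpret Q: comm_group "F Mod K"
    by (rule comm_group.abelian_FactGroup[OF abelian_free_Abelian_group K_subgroup])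
  have T: "carrier T = carrier (F Mod K)" "add T = monoid.mult (F Mod K)"
    "\<zero>\<^bsub>T\<^esub> = one (F Mod K)"
    by (simp_all add: tensor_product_def Let_def del: mult_FactGroup one_FactGroup)
  show ?thesis
    by (rule abelian_groupI; unfold T)
      (rule Q.m_closed Q.one_closed Q.m_assoc Q.m_comm Q.l_one Q.l_inv_ex; assumption)+
qed

sublocale T: abelian_group T by (rule abelian_group_T)

lemma left_act_0: "left_act a 0 = 0"
  and left_act_add: "left_act a (c + d) = left_act a c + left_act a d"
  and left_act_diff: "left_act a (c - d) = left_act a c - left_act a d"
  and left_act_uminus: "left_act a (- c) = - left_act a c"
  and left_act_of: "left_act a (frag_of (x, v)) = frag_of (a \<odot>\<^bsub>X\<^esub> x, v)"
  by (simp_all add: left_act_def frag_extend_add frag_extend_diff frag_extend_minus)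

lemma left_act_closed:
  assumes a: "a \<in> carrier A" and c: "c \<in> carrier F"
  shows "left_act a c \<in> carrier F"
proof -
  have "Poly_Mapping.keys c \<subseteq> carrier X \<times> carrier V" using c by simp
  then have "Poly_Mapping.keys (left_act a c) \<subseteq> carrier X \<times> carrier V"
  proof (induction c rule: frag_induction)
    case (one p)
    then show ?case using a by (cases p) (simp add: left_act_of X.smult_closed)
  qed (simp_all add: left_act_0 left_act_diff keys_diff_subset)
  then show ?thesis by simp
qed

text \<open>Each defining relation is carried to a relation of the same kind, the balancing one
  because the left and right actions commute. Hence the action descends to cosets.\<close>

lemma left_act_K:
  assumes a: "a \<in> carrier A" and k: "k \<in> K"
  shows "left_act a k \<in> K"
  using k
proof (induction k rule: generate.induct)
  case one
  then show ?case by (simp add: left_act_0 K_zero)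
next
  case (incl h)
  then have "left_act a h \<in> tensor_relations R X V"
    unfolding tensor_relations_def
    by (auto simp: left_act_diff left_act_of a X.smult_r_distr smult_rsmult) (metis a X.smult_closed)+
  then show ?case by (rule K_rel)
next
  case (inv h)
  then have "left_act a h \<in> tensor_relations R X V"
    unfolding tensor_relations_def
    by (auto simp: left_act_diff left_act_of a X.smult_r_distr smult_rsmult) (metis a X.smult_closed)+
  moreover have "inv\<^bsub>F\<^esub> h = - h" using inv K_rel K_carrier by (intro inv_free_Abelian_group) blast
  ultimately show ?case using K_rel K_uminus by (simp add: left_act_uminus)
next
  case (eng h1 h2)
  then show ?case by (simp add: left_act_add K_add)
qed

text \<open>By \<open>left_act_K\<close> all representatives of a coset give the same result, so the
  union in \<open>tensor_product\<close> is that of a nonempty constant family.\<close>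

lemma smult_T:
  assumes a: "a \<in> carrier A" and c: "c \<in> carrier F"
  shows "a \<odot>\<^bsub>T\<^esub> coset_of c = coset_of (left_act a c)"
proof -
  have "a \<odot>\<^bsub>T\<^esub> coset_of c = (\<Union>d\<in>coset_of c. coset_of (left_act a d))"
    by (simp add: tensor_product_def Let_def coset_of_def left_act_def)
  also have "\<dots> = (\<Union>d\<in>coset_of c. coset_of (left_act a c))"
  proof (rule SUP_cong)
    fix d assume "d \<in> coset_of c"
    then obtain k where "k \<in> K" "d = k + c" by (auto simp: coset_of_eq)
    then show "coset_of (left_act a d) = coset_of (left_act a c)"
      using left_act_K[OF a] by (simp add: coset_of_eq_iff left_act_add)
  qed simp
  also have "\<dots> = coset_of (left_act a c)"
    using K_zero by (auto simp: coset_of_eq)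
  finally show ?thesis .
qed

lemma left_module_T: "left_module A T"
proof (rule left_moduleI)
  show "ring A" by (rule X.R.ring_axioms)
  show "abelian_group T" by (rule abelian_group_T)
  fix a x assume a: "a \<in> carrier A" and "x \<in> carrier T"
  then obtain c where c: "c \<in> carrier F" "x = coset_of c" by (auto simp: carrier_T)
  show "a \<odot>\<^bsub>T\<^esub> x \<in> carrier T"
    using left_act_closed[OF a] c by (simp add: smult_T[OF a] carrier_T)
  {
    fix b assume b: "b \<in> carrier A"
    have ab: "a \<oplus>\<^bsub>A\<^esub> b \<in> carrier A" "a \<otimes>\<^bsub>A\<^esub> b \<in> carrier A" using a b by simp_all
    have "Poly_Mapping.keys c \<subseteq> carrier X \<times> carrier V" using c by simp
    \<comment> \<open>Distributivity over a sum of scalars holds only modulo \<open>K\<close>, as an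
      instance of the first family of relations; the remaining action laws hold already for
      representatives.\<close>
    then have "left_act (a \<oplus>\<^bsub>A\<^esub> b) c - (left_act a c + left_act b c) \<in> K"
    proof (induction c rule: frag_induction)
      case (one p)
      then obtain y v where p: "p = (y, v)" "y \<in> carrier X" "v \<in> carrier V" by auto
      have "frag_of (a \<odot>\<^bsub>X\<^esub> y \<oplus>\<^bsub>X\<^esub> b \<odot>\<^bsub>X\<^esub> y, v) - frag_of (a \<odot>\<^bsub>X\<^esub> y, v) - frag_of (b \<odot>\<^bsub>X\<^esub> y, v)
        \<in> tensor_relations R X V"
        unfolding tensor_relations_def using a b p X.smult_closed by blast
      then show ?case
        using K_rel a b p by (simp add: left_act_of X.smult_l_distr diff_diff_eq)
    next
      case (diff c d)
      have "left_act (a \<oplus>\<^bsub>A\<^esub> b) (c - d) - (left_act a (c - d) + left_act b (c - d)) =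
        (left_act (a \<oplus>\<^bsub>A\<^esub> b) c - (left_act a c + left_act b c)) -
        (left_act (a \<oplus>\<^bsub>A\<^esub> b) d - (left_act a d + left_act b d))"
        by (simp add: left_act_diff)
      then show ?case using K_diff[OF diff] by simp
    qed (simp add: left_act_0 K_zero)
    then show "(a \<oplus>\<^bsub>A\<^esub> b) \<odot>\<^bsub>T\<^esub> x = a \<odot>\<^bsub>T\<^esub> x \<oplus>\<^bsub>T\<^esub> b \<odot>\<^bsub>T\<^esub> x"
      using a b ab c left_act_closed by (simp add: smult_T add_T coset_of_eq_iff del: carrier_free_Abelian_group_iff)
    have "Poly_Mapping.keys c \<subseteq> carrier X \<times> carrier V" using c by simp
    then have "left_act (a \<otimes>\<^bsub>A\<^esub> b) c = left_act a (left_act b c)"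
      by (induction c rule: frag_induction)
        (use a b in \<open>auto simp: left_act_0 left_act_of left_act_diff X.smult_assoc\<close>)
    then show "(a \<otimes>\<^bsub>A\<^esub> b) \<odot>\<^bsub>T\<^esub> x = a \<odot>\<^bsub>T\<^esub> (b \<odot>\<^bsub>T\<^esub> x)"
      using a b ab c left_act_closed by (simp add: smult_T del: carrier_free_Abelian_group_iff)
  }
  fix y assume "y \<in> carrier T"
  then obtain d where d: "d \<in> carrier F" "y = coset_of d" by (auto simp: carrier_T)
  have cd: "c + d \<in> carrier F" using c d by (simp add: keys_add_subset)
  show "a \<odot>\<^bsub>T\<^esub> (x \<oplus>\<^bsub>T\<^esub> y) = a \<odot>\<^bsub>T\<^esub> x \<oplus>\<^bsub>T\<^esub> a \<odot>\<^bsub>T\<^esub> y"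
    using a c d cd left_act_closed
    by (simp add: smult_T add_T left_act_add del: carrier_free_Abelian_group_iff)
next
  fix x assume "x \<in> carrier T"
  then obtain c where c: "c \<in> carrier F" "x = coset_of c" by (auto simp: carrier_T)
  have "Poly_Mapping.keys c \<subseteq> carrier X \<times> carrier V" using c by simp
  then have "left_act \<one>\<^bsub>A\<^esub> c = c"
    by (induction c rule: frag_induction)
      (auto simp: left_act_0 left_act_of left_act_diff X.smult_one)
  then show "\<one>\<^bsub>A\<^esub> \<odot>\<^bsub>T\<^esub> x = x" using c by (simp add: smult_T del: carrier_free_Abelian_group_iff)
qed

section \<open>Pure tensors and the universal property\<close>

lemma tens_closed: "x \<in> carrier X \<Longrightarrow> v \<in> carrier V \<Longrightarrow> tens x v \<in> carrier T"
  by (auto simp: tens_def carrier_T)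

lemma tens_add_left:
  assumes "x \<in> carrier X" "y \<in> carrier X" "v \<in> carrier V"
  shows "tens (x \<oplus>\<^bsub>X\<^esub> y) v = tens x v \<oplus>\<^bsub>T\<^esub> tens y v"
proof -
  have "frag_of (x \<oplus>\<^bsub>X\<^esub> y, v) - frag_of (x, v) - frag_of (y, v) \<in> tensor_relations R X V"
    unfolding tensor_relations_def using assms by blast
  then show ?thesis
    using K_rel assms by (simp add: tens_def add_T coset_of_eq_iff diff_diff_eq)
qed

lemma tens_add_right:
  assumes "x \<in> carrier X" "v \<in> carrier V" "w \<in> carrier V"
  shows "tens x (v \<oplus>\<^bsub>V\<^esub> w) = tens x v \<oplus>\<^bsub>T\<^esub> tens x w"
proof -
  have "frag_of (x, v \<oplus>\<^bsub>V\<^esub> w) - frag_of (x, v) - frag_of (x, w) \<in> tensor_relations R X V"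
    unfolding tensor_relations_def using assms by blast
  then show ?thesis
    using K_rel assms by (simp add: tens_def add_T coset_of_eq_iff diff_diff_eq)
qed

lemma tens_balanced:
  assumes "x \<in> carrier X" "r \<in> carrier R" "v \<in> carrier V"
  shows "tens (rsmult X x r) v = tens x (r \<odot>\<^bsub>V\<^esub> v)"
proof -
  have "frag_of (rsmult X x r, v) - frag_of (x, r \<odot>\<^bsub>V\<^esub> v) \<in> tensor_relations R X V"
    unfolding tensor_relations_def using assms by blast
  then show ?thesis using K_rel by (simp add: tens_def coset_of_eq_iff)
qed

lemma smult_tens:
  assumes "a \<in> carrier A" "x \<in> carrier X" "v \<in> carrier V"
  shows "a \<odot>\<^bsub>T\<^esub> tens x v = tens (a \<odot>\<^bsub>X\<^esub> x) v"
  using assms by (simp add: tens_def smult_T left_act_of)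

lemma tens_zero_left: "v \<in> carrier V \<Longrightarrow> tens \<zero>\<^bsub>X\<^esub> v = \<zero>\<^bsub>T\<^esub>"
  by (rule additive_zero[OF X.M.abelian_group_axioms T.abelian_group_axioms])
    (simp_all add: tens_closed tens_add_left)

lemma tens_minus_left:
  assumes "x \<in> carrier X" "v \<in> carrier V"
  shows "\<ominus>\<^bsub>T\<^esub> tens x v = tens (\<ominus>\<^bsub>X\<^esub> x) v"
proof (rule T.minus_equality)
  show "tens (\<ominus>\<^bsub>X\<^esub> x) v \<oplus>\<^bsub>T\<^esub> tens x v = \<zero>\<^bsub>T\<^esub>"
    using assms tens_add_left[of "\<ominus>\<^bsub>X\<^esub> x" x v] by (simp add: X.M.l_neg tens_zero_left)
qed (use assms in \<open>simp_all add: tens_closed\<close>)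

text \<open>Negatives of pure tensors are pure tensors, with the sign moved to the left factor, so
  sums suffice. The proof carries \<open>P\<close> for the negative along to get through differences
  in the free abelian group.\<close>

lemma tensor_induct [consumes 1, case_names tens add]:
  assumes t: "t \<in> carrier T"
    and tens: "\<And>x v. x \<in> carrier X \<Longrightarrow> v \<in> carrier V \<Longrightarrow> P (tens x v)"
    and add: "\<And>s t. s \<in> carrier T \<Longrightarrow> t \<in> carrier T \<Longrightarrow> P s \<Longrightarrow> P t \<Longrightarrow> P (s \<oplus>\<^bsub>T\<^esub> t)"
  shows "P t"
proof -
  obtain c where c: "c \<in> carrier F" "t = coset_of c" using t by (auto simp: carrier_T)
  have "Poly_Mapping.keys c \<subseteq> carrier X \<times> carrier V" using c by simp
  then have "P (coset_of c) \<and> P (\<ominus>\<^bsub>T\<^esub> coset_of c)"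
  proof (induction c rule: free_Abelian_group_induct[consumes 1, case_names zero diff of])
    case zero
    have "P \<zero>\<^bsub>T\<^esub>"
      using tens[of "\<zero>\<^bsub>X\<^esub>" "\<zero>\<^bsub>V\<^esub>"] tens_zero_left[of "\<zero>\<^bsub>V\<^esub>"] by simp
    moreover have "\<ominus>\<^bsub>T\<^esub> \<zero>\<^bsub>T\<^esub> = \<zero>\<^bsub>T\<^esub>" by (rule T.minus_equality) simp_all
    ultimately show ?case unfolding zero_T by metis
  next
    case (diff c d)
    have cl: "coset_of c \<in> carrier T" "coset_of d \<in> carrier T"
      using diff by (simp_all add: carrier_T)
    have "coset_of (c - d) \<oplus>\<^bsub>T\<^esub> coset_of d = coset_of c"
      using diff add_T[of "c - d" d] by (simp add: keys_diff_subset)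
    moreover have "coset_of (c - d) \<in> carrier T" using diff by (simp add: carrier_T keys_diff_subset)
    ultimately have eq: "coset_of (c - d) = coset_of c \<oplus>\<^bsub>T\<^esub> \<ominus>\<^bsub>T\<^esub> coset_of d"
      using cl T.add.inv_solve_right by metis
    then have "\<ominus>\<^bsub>T\<^esub> coset_of (c - d) = \<ominus>\<^bsub>T\<^esub> coset_of c \<oplus>\<^bsub>T\<^esub> coset_of d"
      using cl by (simp add: T.minus_add)
    then show ?case using eq add diff cl by simp
  next
    case (of p)
    then obtain x v where "p = (x, v)" "x \<in> carrier X" "v \<in> carrier V" by auto
    then show ?case
      using tens[of x v] tens[of "\<ominus>\<^bsub>X\<^esub> x" v] tens_minus_left[of x v] by (simp add: tens_def)
  qed
  then show ?thesis using c by simp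
qed

text \<open>The map \<open>\<beta>\<close> extends to the free abelian group; its three properties
  annihilate the three families of relations, so the extension factors through the quotient.\<close>

lemma tensor_universal:
  fixes B :: "('x, 'y) ring_scheme"
  assumes B: "abelian_group B"
    and closed: "\<And>x v. x \<in> carrier X \<Longrightarrow> v \<in> carrier V \<Longrightarrow> \<beta> x v \<in> carrier B"
    and add_left: "\<And>x y v. x \<in> carrier X \<Longrightarrow> y \<in> carrier X \<Longrightarrow> v \<in> carrier V \<Longrightarrow>
      \<beta> (x \<oplus>\<^bsub>X\<^esub> y) v = \<beta> x v \<oplus>\<^bsub>B\<^esub> \<beta> y v"
    and add_right: "\<And>x v w. x \<in> carrier X \<Longrightarrow> v \<in> carrier V \<Longrightarrow> w \<in> carrier V \<Longrightarrow>
      \<beta> x (v \<oplus>\<^bsub>V\<^esub> w) = \<beta> x v \<oplus>\<^bsub>B\<^esub> \<beta> x w"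
    and balanced: "\<And>x r v. x \<in> carrier X \<Longrightarrow> r \<in> carrier R \<Longrightarrow> v \<in> carrier V \<Longrightarrow>
      \<beta> (rsmult X x r) v = \<beta> x (r \<odot>\<^bsub>V\<^esub> v)"
  obtains h where "\<And>t. t \<in> carrier T \<Longrightarrow> h t \<in> carrier B"
    and "\<And>s t. s \<in> carrier T \<Longrightarrow> t \<in> carrier T \<Longrightarrow> h (s \<oplus>\<^bsub>T\<^esub> t) = h s \<oplus>\<^bsub>B\<^esub> h t"
    and "\<And>x v. x \<in> carrier X \<Longrightarrow> v \<in> carrier V \<Longrightarrow> h (tens x v) = \<beta> x v"
proof -
  interpret B: abelian_group B by fact
  obtain g where g: "g \<in> hom F (add_monoid B)"
    and g_of: "\<And>p. p \<in> carrier X \<times> carrier V \<Longrightarrow> g (frag_of p) = \<beta> (fst p) (snd p)"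
  proof (rule comm_group.free_Abelian_group_universal[OF B.a_comm_group,
        of "\<lambda>p. \<beta> (fst p) (snd p)" "carrier X \<times> carrier V"])
    show "(\<lambda>p. \<beta> (fst p) (snd p)) ` (carrier X \<times> carrier V) \<subseteq> carrier (add_monoid B)"
      using closed by auto
  qed blast
  have g_closed: "g c \<in> carrier B" if "c \<in> carrier F" for c
    using hom_in_carrier[OF g that] by simp
  have g_add: "g (c + d) = g c \<oplus>\<^bsub>B\<^esub> g d" if "c \<in> carrier F" "d \<in> carrier F" for c d
    using hom_mult[OF g that] by simp
  have g_eq: "g c = g d" if "c \<in> carrier F" "d \<in> carrier F" "g (c - d) = \<zero>\<^bsub>B\<^esub>" for c d
    using g_add[of "c - d" d] that g_closed by (simp add: keys_diff_subset)
  have g_diff0: "g (c - d) = \<zero>\<^bsub>B\<^esub>" if "c \<in> carrier F" "d \<in> carrier F" "g c = g d" for c d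
    using g_add[of "c - d" d] that g_closed[of d] g_closed[of "c - d"]
    by (simp add: keys_diff_subset)
  have g_rel: "g k = \<zero>\<^bsub>B\<^esub>" if k: "k \<in> tensor_relations R X V" for k
  proof -
    from k consider
      (l) x y v where "k = frag_of (x \<oplus>\<^bsub>X\<^esub> y, v) - frag_of (x, v) - frag_of (y, v)"
        "x \<in> carrier X" "y \<in> carrier X" "v \<in> carrier V"
      | (r) x v w where "k = frag_of (x, v \<oplus>\<^bsub>V\<^esub> w) - frag_of (x, v) - frag_of (x, w)"
        "x \<in> carrier X" "v \<in> carrier V" "w \<in> carrier V"
      | (b) x r v where "k = frag_of (rsmult X x r, v) - frag_of (x, r \<odot>\<^bsub>V\<^esub> v)"
        "x \<in> carrier X" "r \<in> carrier R" "v \<in> carrier V"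
      unfolding tensor_relations_def by blast
    then show ?thesis
    proof cases
      case l
      then show ?thesis
        using g_diff0[of "frag_of (x \<oplus>\<^bsub>X\<^esub> y, v)" "frag_of (x, v) + frag_of (y, v)"]
          g_add[of "frag_of (x, v)" "frag_of (y, v)"] keys_add_subset[of "frag_of (x, v)" _ "frag_of (y, v)"]
        by (simp add: g_of add_left diff_diff_eq)
    next
      case r
      then show ?thesis
        using g_diff0[of "frag_of (x, v \<oplus>\<^bsub>V\<^esub> w)" "frag_of (x, v) + frag_of (x, w)"]
          g_add[of "frag_of (x, v)" "frag_of (x, w)"] keys_add_subset[of "frag_of (x, v)" _ "frag_of (x, w)"]
        by (simp add: g_of add_right diff_diff_eq)
    next
      case b
      then show ?thesis
        using g_diff0[of "frag_of (rsmult X x r, v)" "frag_of (x, r \<odot>\<^bsub>V\<^esub> v)"]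
        by (simp add: g_of balanced rsmult_closed V_smult_closed)
    qed
  qed
  have g0: "g 0 = \<zero>\<^bsub>B\<^esub>" using g_diff0[of 0 0] by simp
  have g_K: "g k = \<zero>\<^bsub>B\<^esub>" if "k \<in> K" for k
    using that
  proof (induction k rule: generate.induct)
    case (inv h)
    then have "h \<in> carrier F" using tensor_relations_subset by blast
    then show ?case using g_diff0[of 0 h] g_rel[OF inv] g0 by simp
  next
    case (eng h1 h2)
    then show ?case
      using g_add[of h1 h2] K_carrier by simp
  qed (simp_all add: g0 g_rel)
  obtain h where h: "h \<in> hom (F Mod K) (add_monoid B)"
    and h_coset_of: "\<And>c. c \<in> carrier F \<Longrightarrow> h (K #>\<^bsub>F\<^esub> c) = g c"
  proof (rule FactGroup_universal[OF g K_normal])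
    show "g c = g d" if "c \<in> carrier F" "d \<in> carrier F" "K #>\<^bsub>F\<^esub> c = K #>\<^bsub>F\<^esub> d" for c d
      using that g_eq g_K coset_of_eq_iff[of c d] unfolding coset_of_def by blast
  qed blast
  have carrier: "carrier T = carrier (F Mod K)" and add: "add T = monoid.mult (F Mod K)"
    by (simp_all add: tensor_product_def Let_def)
  show ?thesis
  proof (rule that[of h])
    show "h t \<in> carrier B" if "t \<in> carrier T" for t
      using hom_in_carrier[OF h, of t] that carrier by simp
    show "h (s \<oplus>\<^bsub>T\<^esub> t) = h s \<oplus>\<^bsub>B\<^esub> h t" if "s \<in> carrier T" "t \<in> carrier T" for s t
      using hom_mult[OF h, of s t] that carrier add by simp
    show "h (tens x v) = \<beta> x v" if "x \<in> carrier X" "v \<in> carrier V" for x v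
      using h_coset_of[of "frag_of (x, v)"] g_of that by (simp add: tens_def coset_of_def)
  qed
qed

end

section \<open>Induced modules\<close>

text \<open>This encodes the convention that products leaving the set count as zero: the left action
  in \<open>L_bimodule\<close> is convolution followed by this truncation.\<close>

definition restr :: "'s set \<Rightarrow> ('s \<Rightarrow> 'k) \<Rightarrow> 's \<Rightarrow> 'k::zero" where
  "restr T f = (\<lambda>u. if u \<in> T then f u else 0)"

lemma restr_in_funs_on: "restr T f \<in> funs_on T"
  by (simp add: restr_def funs_on_def)

lemma restr_ident: "f \<in> funs_on T \<Longrightarrow> restr T f = f"
  by (auto simp: restr_def funs_on_def)

lemma restr_add: "restr T (\<lambda>s. f s + g s) = (\<lambda>s. restr T f s + restr T g s :: 'k::monoid_add)"
  by (auto simp: restr_def)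

lemma restr_point: "restr T (point s k) = (if s \<in> T then point s k else (\<lambda>_. 0))"
  by (auto simp: restr_def point_def)

text \<open>An inner truncation is invisible after the outer one if the terms it discards cannot
  produce anything in \<open>C\<close>.\<close>

lemma restr_convolution_right:
  assumes h: "h \<in> funs_on B" and BCD: "\<And>s t. t \<in> B \<Longrightarrow> s * t \<in> C \<Longrightarrow> t \<in> D"
  shows "restr C (convolution a (restr D h)) = restr C (convolution a h)"
proof
  fix u
  have "a s * restr D h t = a s * h t" if "u \<in> C" "s * t = u" for s t
    using that h BCD[of t s] unfolding restr_def funs_on_def by fastforce
  then have "(\<Sum>(s, t) | s * t = u. a s * restr D h t) = (\<Sum>(s, t) | s * t = u. a s * h t)" if "u \<in> C"
    using that by (intro sum.cong) auto
  then show "restr C (convolution a (restr D h)) u = restr C (convolution a h) u"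
    by (simp add: restr_def convolution_def)
qed

lemma restr_convolution_left:
  assumes h: "h \<in> funs_on B" and r: "r \<in> funs_on H"
    and BCD: "\<And>s t. s \<in> B \<Longrightarrow> t \<in> H \<Longrightarrow> s * t \<in> C \<Longrightarrow> s \<in> D"
  shows "restr C (convolution (restr D h) r) = restr C (convolution h r)"
proof
  fix u
  have "restr D h s * r t = h s * r t" if "u \<in> C" "s * t = u" for s t
    using that h r BCD[of s t] unfolding restr_def funs_on_def by fastforce
  then have "(\<Sum>(s, t) | s * t = u. restr D h s * r t) = (\<Sum>(s, t) | s * t = u. h s * r t)" if "u \<in> C"
    using that by (intro sum.cong) auto
  then show "restr C (convolution (restr D h) r) u = restr C (convolution h r) u"
    by (simp add: restr_def convolution_def)
qed

lemma L_bimodule_simps: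
  "carrier (L_bimodule e) = funs_on (Lclass e)"
  "x \<oplus>\<^bsub>L_bimodule e\<^esub> y = (\<lambda>s. x s + y s)"
  "\<zero>\<^bsub>L_bimodule e\<^esub> = (\<lambda>_. 0)"
  "a \<odot>\<^bsub>L_bimodule e\<^esub> x = restr (Lclass e) (convolution a x)"
  "rsmult (L_bimodule e) x r = convolution x r"
  by (simp_all add: L_bimodule_def funs_on_def restr_def)

lemma Lclass_self: "e \<in> Lclass e"
  by (simp add: Lclass_def)

text \<open>Left multiplication never leads back from the rest of \<open>S e\<close> into the
  L-class. This makes the truncated action associative.\<close>

lemma Lclass_of_mult:
  fixes e :: "'s::semigroup_mult"
  assumes e: "e * e = e" and t: "t * e = t" and st: "s * t \<in> Lclass e"
  shows "t \<in> Lclass e"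
proof -
  obtain w where "w * (s * t) = e" using st Lclass_idempotent_iff[OF e] by blast
  then have "(w * s) * t = e" by (simp add: mult.assoc)
  then show ?thesis using t Lclass_idempotent_iff[OF e] by blast
qed

text \<open>Cancelling \<open>h\<close> on the right gives \<open>e * s = s\<close>, and then
  \<open>Hclass_of_Lclass\<close> applies. As a consequence, truncation from \<open>\<L>(e)\<close>
  to \<open>G\<^sub>e\<close> respects right multiplication by \<open>G\<^sub>e\<close>.\<close>

lemma Hclass_of_mult_Hclass:
  fixes e :: "'s::{semigroup_mult,finite}"
  assumes e: "e * e = e" and s: "s \<in> Lclass e" and h: "h \<in> Hclass e" and sh: "s * h \<in> Hclass e"
  shows "s \<in> Hclass e"
proof -
  obtain v where v: "h * v = e" using h Hclass_idempotent_iff[OF e] by blast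
  have "e * (s * h) = s * h" using sh Hclass_idempotent_iff[OF e] by blast
  then have "e * (s * (h * v)) = s * (h * v)" by (metis mult.assoc)
  moreover have "s * e = s" using s Lclass_idempotent_iff[OF e] by blast
  ultimately show ?thesis using Hclass_of_Lclass[OF e s] v by simp
qed

context right_restriction_EI
begin

abbreviation algebra :: "('s \<Rightarrow> 'k::field) ring" where
  "algebra \<equiv> semigroup_algebra UNIV"

lemma carrier_algebra: "f \<in> carrier algebra"
  by (simp add: semigroup_algebra_simps funs_on_UNIV)

section \<open>Modules over the algebra of the semigroup\<close>

lemma smult_convolution:
  assumes "left_module algebra M" and "m \<in> carrier M"
  shows "convolution f g \<odot>\<^bsub>M\<^esub> m = f \<odot>\<^bsub>M\<^esub> (g \<odot>\<^bsub>M\<^esub> m)"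
  using left_module.smult_assoc[OF assms(1) carrier_algebra carrier_algebra assms(2), of f g]
  by (simp add: semigroup_algebra_simps)

lemma smult_point_mult:
  assumes "left_module algebra M" and "m \<in> carrier M"
  shows "point (s * t) 1 \<odot>\<^bsub>M\<^esub> m = point s 1 \<odot>\<^bsub>M\<^esub> (point t (1 :: 'k::field) \<odot>\<^bsub>M\<^esub> m)"
  using smult_convolution[OF assms, of "point s 1" "point t 1"] by (simp add: convolution_point)

lemma smult_eq_zeroI:
  fixes f :: "'s \<Rightarrow> 'k::field"
  assumes M: "left_module algebra M" and m: "m \<in> carrier M"
    and f: "f \<in> funs_on Q" and zero: "\<And>q. q \<in> Q \<Longrightarrow> point q 1 \<odot>\<^bsub>M\<^esub> m = \<zero>\<^bsub>M\<^esub>"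
  shows "f \<odot>\<^bsub>M\<^esub> m = \<zero>\<^bsub>M\<^esub>"
proof -
  interpret M: left_module algebra M by fact
  show ?thesis
    using f
  proof (induction rule: funs_on_induct)
    case zero
    then show ?case using M.smult_zero_left[OF m] by (simp add: semigroup_algebra_simps)
  next
    case (point q k)
    \<comment> \<open>The coefficient is moved into a left factor: \<open>k q\<close> is the product
      of \<open>k q\<^sup>+\<close> and \<open>q\<close>, so it suffices that \<open>q\<close> kills
      \<open>m\<close>.\<close>
    have "point q k = convolution (point (plus E q) k) (point q 1)"
      by (simp add: convolution_point plus_mult)
    then show ?case
      using smult_convolution[OF M m, of "point (plus E q) k" "point q 1"]
        zero[OF point] M.smult_zero_right[OF carrier_algebra, of "point (plus E q) k"] by simp
  next
    case (add f g)
    then show ?case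
      using M.smult_l_distr[OF carrier_algebra carrier_algebra m, of f g]
      by (simp add: semigroup_algebra_simps)
  qed
qed

lemma L_bimodule_left_module:
  assumes e: "e * e = e"
  shows "left_module algebra (L_bimodule e :: ('s \<Rightarrow> 'k::field, 's \<Rightarrow> 'k, 's \<Rightarrow> 'k) bimodule)"
    (is "left_module _ ?X")
proof (rule left_moduleI)
  show "ring (algebra :: ('s \<Rightarrow> 'k) ring)" by (rule ring_algebra)
  show "abelian_group ?X"
  proof (rule abelian_groupI)
    fix x :: "'s \<Rightarrow> 'k" assume "x \<in> carrier ?X"
    then have "(\<lambda>s. - x s) \<in> carrier ?X" "(\<lambda>s. - x s) \<oplus>\<^bsub>?X\<^esub> x = \<zero>\<^bsub>?X\<^esub>"
      by (simp_all add: L_bimodule_simps funs_on_def)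
    then show "\<exists>y\<in>carrier ?X. y \<oplus>\<^bsub>?X\<^esub> x = \<zero>\<^bsub>?X\<^esub>" by blast
  qed (auto simp: L_bimodule_simps funs_on_add funs_on_zero add.assoc add.commute)
  fix a b f :: "'s \<Rightarrow> 'k" assume f: "f \<in> carrier ?X"
  \<comment> \<open>For associativity: \<open>convolution b f\<close> is supported on
    \<open>S e\<close>, where \<open>Lclass_of_mult\<close> shows that the terms lost in the inner
    truncation never return.\<close>
  have "convolution b f \<in> funs_on {s. s * e = s}"
    by (rule convolution_in_funs_on[of b UNIV f "Lclass e"])
      (use f Lclass_idempotent_iff[OF e] in \<open>auto simp: L_bimodule_simps funs_on_UNIV mult.assoc\<close>)
  from restr_convolution_right[OF this, of "Lclass e" "Lclass e" a]
  show "(a \<otimes>\<^bsub>algebra\<^esub> b) \<odot>\<^bsub>?X\<^esub> f = a \<odot>\<^bsub>?X\<^esub> (b \<odot>\<^bsub>?X\<^esub> f)"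
    using Lclass_of_mult[OF e] by (simp add: L_bimodule_simps semigroup_algebra_simps convolution_assoc)
qed (auto simp: L_bimodule_simps semigroup_algebra_simps restr_in_funs_on restr_add restr_ident
    convolution_add_left convolution_add_right algebra_unit)

end

locale induction_data = right_restriction_EI E for E :: "'s::{semigroup_mult,finite} set" +
  fixes e :: 's and V :: "('s \<Rightarrow> 'k::field, 'v) module"
  assumes e: "e * e = e" and V: "left_module (semigroup_algebra (Hclass e)) V"
begin

sublocale V: left_module "semigroup_algebra (Hclass e)" V by (rule V)

sublocale ten: bimodule_tensor algebra "semigroup_algebra (Hclass e)" "L_bimodule e" V
proof (intro bimodule_tensor.intro bimodule_tensor_axioms.intro)
  show "left_module algebra (L_bimodule e :: ('s \<Rightarrow> 'k, 's \<Rightarrow> 'k, 's \<Rightarrow> 'k) bimodule)"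
    by (rule L_bimodule_left_module[OF e])
  show "abelian_group V" by (rule V.M.abelian_group_axioms)
next
  fix x r :: "'s \<Rightarrow> 'k"
  assume xr: "x \<in> carrier (L_bimodule e)" "r \<in> carrier (semigroup_algebra (Hclass e))"
  then show rs: "rsmult (L_bimodule e) x r \<in> carrier (L_bimodule e)"
    using convolution_in_funs_on[of x "Lclass e" r "Hclass e" "Lclass e"] Lclass_mult_Hclass[OF e]
    by (simp add: L_bimodule_simps semigroup_algebra_simps)
  fix a :: "'s \<Rightarrow> 'k"
  have ax: "convolution a x \<in> funs_on {s. s * e = s}"
    by (rule convolution_in_funs_on[of a UNIV x "Lclass e"])
      (use xr Lclass_idempotent_iff[OF e] in \<open>auto simp: L_bimodule_simps funs_on_UNIV mult.assoc\<close>)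
  \<comment> \<open>The two actions commute because right multiplication by group elements preserves
    both \<open>\<L>(e)\<close> and its complement in \<open>S e\<close>, so truncation can be moved
    past it.\<close>
  have "restr (Lclass e) (convolution (convolution a x) r) =
    restr (Lclass e) (convolution (restr (Lclass e) (convolution a x)) r)"
    by (rule restr_convolution_left[OF ax, symmetric])
      (use xr Lclass_of_mult_Hclass[OF e] in \<open>auto simp: semigroup_algebra_simps\<close>)
  also have "\<dots> = convolution (restr (Lclass e) (convolution a x)) r"
    by (intro restr_ident convolution_in_funs_on[OF restr_in_funs_on])
      (use xr Lclass_mult_Hclass[OF e] in \<open>auto simp: semigroup_algebra_simps\<close>)
  finally show "a \<odot>\<^bsub>L_bimodule e\<^esub> rsmult (L_bimodule e) x r = rsmult (L_bimodule e) (a \<odot>\<^bsub>L_bimodule e\<^esub> x) r"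
    by (simp add: L_bimodule_simps convolution_assoc)
qed (rule V.smult_closed)

lemma Ind_eq: "Ind e V = ten.T"
  by (simp add: Ind_def)

sublocale ind: left_module algebra "Ind e V"
  unfolding Ind_eq by (rule ten.left_module_T)

text \<open>The embedding of \<open>V\<close> as \<open>e \<otimes> V\<close>. By
  \<open>iota_retraction\<close> and \<open>point_e_iota\<close> it is injective with image
  \<open>e Ind(V)\<close>.\<close>

definition iota :: "'v \<Rightarrow> (('s \<Rightarrow> 'k) \<times> 'v \<Rightarrow>\<^sub>0 int) set" where
  "iota v = ten.tens (point e 1) v"

lemma point_e_in: "point e 1 \<in> carrier (L_bimodule e)"
  by (simp add: L_bimodule_simps point_in_funs_on Lclass_self)

lemma iota_closed: "v \<in> carrier V \<Longrightarrow> iota v \<in> carrier (Ind e V)"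
  unfolding iota_def Ind_eq by (rule ten.tens_closed[OF point_e_in])

lemma iota_add: "v \<in> carrier V \<Longrightarrow> w \<in> carrier V \<Longrightarrow> iota (v \<oplus>\<^bsub>V\<^esub> w) = iota v \<oplus>\<^bsub>Ind e V\<^esub> iota w"
  unfolding iota_def Ind_eq by (rule ten.tens_add_right[OF point_e_in])

lemma iota_zero: "iota \<zero>\<^bsub>V\<^esub> = \<zero>\<^bsub>Ind e V\<^esub>"
  by (rule additive_zero[OF V.M.abelian_group_axioms ind.M.abelian_group_axioms iota_closed iota_add])

lemma smult_iota:
  assumes f: "f \<in> funs_on {s. s * e = s}" and v: "v \<in> carrier V"
  shows "f \<odot>\<^bsub>Ind e V\<^esub> iota v = ten.tens (restr (Lclass e) f) v"
proof -
  have "f \<odot>\<^bsub>Ind e V\<^esub> iota v = ten.tens (f \<odot>\<^bsub>L_bimodule e\<^esub> point e 1) v"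
    unfolding iota_def Ind_eq by (rule ten.smult_tens[OF carrier_algebra point_e_in v])
  moreover have "convolution f (point e 1) = f"
    using f by (induction rule: funs_on_induct)
      (simp_all add: convolution_point convolution_zero_left convolution_add_left)
  ultimately show ?thesis by (simp add: L_bimodule_simps)
qed

lemma Lclass_subset: "Lclass e \<subseteq> {s. s * e = s}"
  using Lclass_idempotent_iff[OF e] by blast

lemma tens_eq_smult_iota:
  "f \<in> funs_on (Lclass e) \<Longrightarrow> v \<in> carrier V \<Longrightarrow> ten.tens f v = f \<odot>\<^bsub>Ind e V\<^esub> iota v"
  using smult_iota[OF funs_on_mono[OF _ Lclass_subset]] by (simp add: restr_ident)

lemma smult_iota_zero:
  assumes "s * e = s" and "s \<notin> Lclass e" and v: "v \<in> carrier V"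
  shows "point s 1 \<odot>\<^bsub>Ind e V\<^esub> iota v = \<zero>\<^bsub>Ind e V\<^esub>"
proof -
  have "point s 1 \<odot>\<^bsub>Ind e V\<^esub> iota v = ten.tens (\<lambda>_. 0) v"
    using assms smult_iota[of "point s 1" v] by (simp add: point_in_funs_on restr_point)
  then show ?thesis using ten.tens_zero_left[OF v] by (simp add: L_bimodule_simps Ind_eq)
qed

lemma iota_smult:
  assumes g: "g \<in> carrier (semigroup_algebra (Hclass e))" and v: "v \<in> carrier V"
  shows "iota (g \<odot>\<^bsub>V\<^esub> v) = g \<odot>\<^bsub>Ind e V\<^esub> iota v"
proof -
  have g': "g \<in> funs_on (Hclass e)" using g by (simp add: semigroup_algebra_simps)
  have "iota (g \<odot>\<^bsub>V\<^esub> v) = ten.tens (convolution (point e 1) g) v"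
    unfolding iota_def using ten.tens_balanced[OF point_e_in g v] by (simp add: L_bimodule_simps)
  also have "\<dots> = ten.tens g v" using group_algebra_unit[OF e g'] by simp
  also have "\<dots> = g \<odot>\<^bsub>Ind e V\<^esub> iota v"
    using tens_eq_smult_iota[OF funs_on_mono[OF g' Hclass_subset_Lclass] v] .
  finally show ?thesis .
qed

lemma Ind_induct [consumes 1, case_names point add]:
  assumes t: "t \<in> carrier (Ind e V)"
    and point: "\<And>x v. x \<in> Lclass e \<Longrightarrow> v \<in> carrier V \<Longrightarrow> P (point x 1 \<odot>\<^bsub>Ind e V\<^esub> iota v)"
    and add: "\<And>s t. s \<in> carrier (Ind e V) \<Longrightarrow> t \<in> carrier (Ind e V) \<Longrightarrow> P s \<Longrightarrow> P t \<Longrightarrow>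
      P (s \<oplus>\<^bsub>Ind e V\<^esub> t)"
  shows "P t"
proof -
  have P: "P (f \<odot>\<^bsub>Ind e V\<^esub> iota v)" if f: "f \<in> funs_on (Lclass e)" and v: "v \<in> carrier V" for f v
    using f
  proof (induction rule: funs_on_induct)
    case zero
    have "point e 1 \<odot>\<^bsub>Ind e V\<^esub> iota \<zero>\<^bsub>V\<^esub> = \<zero>\<^bsub>Ind e V\<^esub>"
      unfolding iota_zero by (rule ind.smult_zero_right[OF carrier_algebra])
    then have "P \<zero>\<^bsub>Ind e V\<^esub>"
      using point[OF Lclass_self, of "\<zero>\<^bsub>V\<^esub>"] by simp
    then show ?case
      using ind.smult_zero_left[OF iota_closed[OF v]] by (simp add: semigroup_algebra_simps)
  next
    case (point x k)
    have ek: "point e k \<in> carrier (semigroup_algebra (Hclass e))"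
      using point_in_funs_on[OF Hclass_self] by (simp add: semigroup_algebra_simps)
    have "x * e = x" using point Lclass_subset by blast
    \<comment> \<open>The scalar is passed across the tensor sign: \<open>k x\<close> is
      \<open>x\<close> times \<open>k e\<close>, and \<open>k e\<close> belongs to the group algebra
      and acts on \<open>V\<close>.\<close>
    then have "point x k = convolution (point x 1) (point e k)" by (simp add: convolution_point)
    then have "point x k \<odot>\<^bsub>Ind e V\<^esub> iota v = point x 1 \<odot>\<^bsub>Ind e V\<^esub> iota (point e k \<odot>\<^bsub>V\<^esub> v)"
      using smult_convolution[OF ind.left_module_axioms iota_closed[OF v]] iota_smult[OF ek v] by simp
    then show ?case using assms(2)[OF point V.smult_closed[OF ek v]] by simp
  next
    case (add f g)
    then show ?case
      using ind.smult_l_distr[OF carrier_algebra carrier_algebra iota_closed[OF v], of f g]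
        ind.smult_closed[OF carrier_algebra iota_closed[OF v]] assms(3)
      by (simp add: semigroup_algebra_simps)
  qed
  from t show ?thesis
    unfolding Ind_eq
  proof (induction rule: ten.tensor_induct)
    case (tens x v)
    then show ?case using P tens_eq_smult_iota by (simp add: L_bimodule_simps)
  next
    case (add s t)
    then show ?case using assms(3) by (simp add: Ind_eq)
  qed
qed

text \<open>The map \<open>p\<close> truncates the left factor to \<open>G\<^sub>e\<close> and lets
  it act on \<open>V\<close>. If \<open>x\<close> lies in \<open>\<L>(e)\<close>, then
  \<open>e * x\<close> either leaves the L-class and gives zero, or lies in \<open>G\<^sub>e\<close>
  and is absorbed into \<open>V\<close>; so \<open>e Ind(V)\<close> is contained in the image of
  \<open>iota\<close>.\<close>

lemma iota_retraction:
  "\<exists>p. (\<forall>t \<in> carrier (Ind e V). p t \<in> carrier V) \<and> p \<zero>\<^bsub>Ind e V\<^esub> = \<zero>\<^bsub>V\<^esub> \<and>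
    (\<forall>v \<in> carrier V. p (iota v) = v) \<and>
    (\<forall>t \<in> carrier (Ind e V). iota (p (point e 1 \<odot>\<^bsub>Ind e V\<^esub> t)) = point e 1 \<odot>\<^bsub>Ind e V\<^esub> t)"
proof -
  let ?\<beta> = "\<lambda>f v. restr (Hclass e) f \<odot>\<^bsub>V\<^esub> v"
  have restr_G: "restr (Hclass e) f \<in> carrier (semigroup_algebra (Hclass e))" for f :: "'s \<Rightarrow> 'k"
    by (simp add: semigroup_algebra_simps restr_in_funs_on)
  obtain p where p: "\<And>t. t \<in> carrier (Ind e V) \<Longrightarrow> p t \<in> carrier V"
    and p_add: "\<And>s t. s \<in> carrier (Ind e V) \<Longrightarrow> t \<in> carrier (Ind e V) \<Longrightarrow>
      p (s \<oplus>\<^bsub>Ind e V\<^esub> t) = p s \<oplus>\<^bsub>V\<^esub> p t"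
    and p_tens: "\<And>x v. x \<in> carrier (L_bimodule e) \<Longrightarrow> v \<in> carrier V \<Longrightarrow> p (ten.tens x v) = ?\<beta> x v"
    unfolding Ind_eq
  proof (rule ten.tensor_universal[OF V.M.abelian_group_axioms, of ?\<beta>])
    fix x r :: "'s \<Rightarrow> 'k" and v
    assume xr: "x \<in> carrier (L_bimodule e)" "r \<in> carrier (semigroup_algebra (Hclass e))"
      and v: "v \<in> carrier V"
    have "restr (Hclass e) (convolution (restr (Hclass e) x) r) = restr (Hclass e) (convolution x r)"
      by (rule restr_convolution_left[of x "Lclass e" r "Hclass e"])
        (use xr Hclass_of_mult_Hclass[OF e] in \<open>auto simp: L_bimodule_simps semigroup_algebra_simps\<close>)
    moreover have "convolution (restr (Hclass e) x) r \<in> funs_on (Hclass e)"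
      by (rule convolution_in_funs_on[OF restr_in_funs_on])
        (use xr Hclass_mult_closed[OF e] in \<open>auto simp: semigroup_algebra_simps\<close>)
    ultimately have "restr (Hclass e) (convolution x r) = convolution (restr (Hclass e) x) r"
      by (simp add: restr_ident)
    then show "?\<beta> (rsmult (L_bimodule e) x r) v = ?\<beta> x (r \<odot>\<^bsub>V\<^esub> v)"
      using V.smult_assoc[OF restr_G xr(2) v, of x]
      by (simp add: L_bimodule_simps semigroup_algebra_simps)
  next
    fix x y :: "'s \<Rightarrow> 'k" and v assume v: "v \<in> carrier V"
    show "?\<beta> (x \<oplus>\<^bsub>L_bimodule e\<^esub> y) v = ?\<beta> x v \<oplus>\<^bsub>V\<^esub> ?\<beta> y v"
      using V.smult_l_distr[OF restr_G restr_G v, of x y]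
      by (simp add: L_bimodule_simps semigroup_algebra_simps restr_add)
  qed (use V.smult_closed V.smult_r_distr restr_G in \<open>auto simp: Ind_eq\<close>)
  have p0: "p \<zero>\<^bsub>Ind e V\<^esub> = \<zero>\<^bsub>V\<^esub>"
    by (rule additive_zero[OF ind.M.abelian_group_axioms V.M.abelian_group_axioms p p_add])
  have p_iota: "p (iota v) = v" if v: "v \<in> carrier V" for v
    using p_tens[OF point_e_in v] V.smult_one[OF v]
    unfolding iota_def by (simp add: restr_point Hclass_self one_group_algebra[OF e])
  have "iota (p (point e 1 \<odot>\<^bsub>Ind e V\<^esub> t)) = point e 1 \<odot>\<^bsub>Ind e V\<^esub> t" if "t \<in> carrier (Ind e V)" for t
    using that
  proof (induction rule: Ind_induct)
    case (point x v)
    have ex: "point e 1 \<odot>\<^bsub>Ind e V\<^esub> (point x 1 \<odot>\<^bsub>Ind e V\<^esub> iota v) = point (e * x) 1 \<odot>\<^bsub>Ind e V\<^esub> iota v"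
      using smult_point_mult[OF ind.left_module_axioms iota_closed[OF point(2)], of e x] by simp
    have exe: "e * x * e = e * x" using point(1) Lclass_subset by (auto simp: mult.assoc)
    show ?case
    proof (cases "e * x \<in> Lclass e")
      case True
      have "e * (e * x) = e * x" using e by (simp flip: mult.assoc)
      then have "e * x \<in> Hclass e" using Hclass_of_Lclass[OF e True] by simp
      then have G: "point (e * x) 1 \<in> carrier (semigroup_algebra (Hclass e))"
        by (simp add: semigroup_algebra_simps point_in_funs_on)
      show ?thesis
        unfolding ex iota_smult[OF G point(2), symmetric]
        using p_iota V.smult_closed[OF G point(2)] by simp
    next
      case False
      show ?thesis
        unfolding ex smult_iota_zero[OF exe False point(2)] p0 iota_zero ..
    qed
  next
    case (add s t)
    then show ?case
      using ind.smult_r_distr[OF carrier_algebra, of s t "point e 1"] ind.smult_closed[OF carrier_algebra]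
      by (simp add: p_add p iota_add)
  qed
  then show ?thesis using p p0 p_iota by (intro exI[of _ p] conjI ballI)
qed

lemma proj_unit:
  assumes t: "t \<in> carrier (Ind e V)"
  shows "(\<lambda>s. if s \<in> proj e then 1 else 0) \<odot>\<^bsub>Ind e V\<^esub> t = t"
  using t
proof (induction rule: Ind_induct)
  case (point x v)
  let ?u = "\<lambda>s. if s \<in> proj e then 1 else 0 :: 'k"
  obtain q where q: "q \<in> proj e" "q * x = x"
    and uniq: "\<And>r. r \<in> proj e \<Longrightarrow> r * x \<in> Lclass e \<Longrightarrow> r = q"
    using proj_separates_Lclass[OF e point(1)] by blast
  \<comment> \<open>The remaining elements of \<open>proj e\<close>: each moves \<open>x\<close> out
    of the L-class while staying in \<open>S e\<close>, so together they contribute zero.\<close>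
  let ?w = "\<lambda>s. if s \<in> proj e - {q} then 1 else 0 :: 'k"
  have "?u = (\<lambda>s. point q 1 s + ?w s)" using q by (auto simp: point_def)
  then have "convolution ?u (point x 1) = (\<lambda>s. point x 1 s + convolution ?w (point x 1) s)"
    by (simp only: convolution_add_left convolution_point q) simp
  moreover have "convolution ?w (point x 1) \<in> funs_on {s. s * e = s \<and> s \<notin> Lclass e}"
  proof (rule convolution_in_funs_on)
    show "?w \<in> funs_on (proj e - {q})" by (simp add: funs_on_def)
    show "point x 1 \<in> funs_on {x}" by (simp add: point_in_funs_on)
  qed (use uniq point(1) Lclass_subset in \<open>auto simp: mult.assoc\<close>)
  then have "convolution ?w (point x 1) \<odot>\<^bsub>Ind e V\<^esub> iota v = \<zero>\<^bsub>Ind e V\<^esub>"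
    by (rule smult_eq_zeroI[OF ind.left_module_axioms iota_closed[OF point(2)]])
      (use smult_iota_zero point(2) in auto)
  ultimately show ?case
    using smult_convolution[OF ind.left_module_axioms iota_closed[OF point(2)], of ?u "point x 1"]
      ind.smult_l_distr[OF carrier_algebra carrier_algebra iota_closed[OF point(2)],
        of "point x 1" "convolution ?w (point x 1)"]
      ind.smult_closed[OF carrier_algebra iota_closed[OF point(2)]]
    by (simp add: semigroup_algebra_simps)
next
  case (add s t)
  then show ?case using ind.smult_r_distr[OF carrier_algebra, of s t] by simp
qed

text \<open>If every \<open>s * x\<close> with \<open>x\<close> in \<open>\<L>(e)\<close> left the
  L-class, \<open>s\<close> would act as zero; if some \<open>s * x\<close> stays, \<open>e\<close>
  is a multiple of \<open>s\<close>. So the J-class of \<open>e\<close> is the least one acting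
  nontrivially.\<close>

lemma nonzero_action_ideal1:
  assumes t: "t \<in> carrier (Ind e V)" and nz: "point s 1 \<odot>\<^bsub>Ind e V\<^esub> t \<noteq> \<zero>\<^bsub>Ind e V\<^esub>"
  shows "ideal1 e \<subseteq> ideal1 s"
proof (rule ccontr)
  assume no: "\<not> ideal1 e \<subseteq> ideal1 s"
  have "point s 1 \<odot>\<^bsub>Ind e V\<^esub> t = \<zero>\<^bsub>Ind e V\<^esub>"
    using t
  proof (induction rule: Ind_induct)
    case (point x v)
    have "s * x \<notin> Lclass e"
    proof
      assume "s * x \<in> Lclass e"
      then obtain w where "w * (s * x) = e" using Lclass_idempotent_iff[OF e] by blast
      then have "e = w * s * x" by (simp add: mult.assoc)
      then show False using no unfolding ideal1_subset_iff by (auto simp: ideal1_def)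
    qed
    moreover have "s * x * e = s * x" using point(1) Lclass_subset by (auto simp: mult.assoc)
    ultimately show ?case
      using smult_iota_zero point(2)
        smult_point_mult[OF ind.left_module_axioms iota_closed[OF point(2)], of s x] by simp
  next
    case (add s' t)
    then show ?case using ind.smult_r_distr[OF carrier_algebra, of s' t] by simp
  qed
  then show False using nz by simp
qed

lemma Ind_nonzero:
  assumes "carrier V \<noteq> {\<zero>\<^bsub>V\<^esub>}"
  obtains v where "v \<in> carrier V" "iota v \<noteq> \<zero>\<^bsub>Ind e V\<^esub>"
proof -
  obtain v where v: "v \<in> carrier V" "v \<noteq> \<zero>\<^bsub>V\<^esub>" using assms V.M.zero_closed by blast
  obtain p where "p \<zero>\<^bsub>Ind e V\<^esub> = \<zero>\<^bsub>V\<^esub>" "\<And>v. v \<in> carrier V \<Longrightarrow> p (iota v) = v"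
    using iota_retraction by blast
  then have "iota v \<noteq> \<zero>\<^bsub>Ind e V\<^esub>" using v by metis
  then show ?thesis using that v by blast
qed

lemma point_e_iota: "v \<in> carrier V \<Longrightarrow> point e 1 \<odot>\<^bsub>Ind e V\<^esub> iota v = iota v"
  using tens_eq_smult_iota[OF point_in_funs_on[OF Lclass_self], of v 1] unfolding iota_def by (rule sym)

lemma simple_Ind:
  assumes simple: "simple_module (semigroup_algebra (Hclass e)) V"
  shows "simple_module algebra (Ind e V)"
proof (rule simple_moduleI[OF ind.left_module_axioms])
  have V_nz: "carrier V \<noteq> {\<zero>\<^bsub>V\<^esub>}" using simple by (simp add: simple_module_def)
  obtain v where "v \<in> carrier V" "iota v \<noteq> \<zero>\<^bsub>Ind e V\<^esub>" by (rule Ind_nonzero[OF V_nz])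
  then show "carrier (Ind e V) \<noteq> {\<zero>\<^bsub>Ind e V\<^esub>}" using iota_closed[of v] by auto
  fix N assume N: "submodule N algebra (Ind e V)"
  note ND = submoduleD[OF N]
  have "N = carrier (Ind e V)" if "N \<noteq> {\<zero>\<^bsub>Ind e V\<^esub>}"
  proof -
    have "\<not> N \<subseteq> {\<zero>\<^bsub>Ind e V\<^esub>}" using that ND(2) by auto
    then obtain t where t: "t \<in> N" "t \<noteq> \<zero>\<^bsub>Ind e V\<^esub>" by auto
    have tc: "t \<in> carrier (Ind e V)" using t ND(1) by blast
    \<comment> \<open>Otherwise the sum of all these \<open>q\<close>, which is the identity on the
      induced module by \<open>proj_unit\<close>, would kill \<open>t\<close>.\<close>
    have "\<exists>q\<in>proj e. point q 1 \<odot>\<^bsub>Ind e V\<^esub> t \<noteq> \<zero>\<^bsub>Ind e V\<^esub>"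
    proof (rule ccontr)
      assume "\<not> (\<exists>q\<in>proj e. point q 1 \<odot>\<^bsub>Ind e V\<^esub> t \<noteq> \<zero>\<^bsub>Ind e V\<^esub>)"
      then have zero: "point q 1 \<odot>\<^bsub>Ind e V\<^esub> t = \<zero>\<^bsub>Ind e V\<^esub>" if "q \<in> proj e" for q
        using that by simp
      have "(\<lambda>s. if s \<in> proj e then 1 else 0) \<odot>\<^bsub>Ind e V\<^esub> t = \<zero>\<^bsub>Ind e V\<^esub>"
        by (rule smult_eq_zeroI[OF ind.left_module_axioms tc _ zero]) (simp_all add: funs_on_def)
      then show False using proj_unit[OF tc] t(2) by simp
    qed
    then obtain q where q: "q \<in> proj e" "point q 1 \<odot>\<^bsub>Ind e V\<^esub> t \<noteq> \<zero>\<^bsub>Ind e V\<^esub>" by blast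
    then obtain x y where xy: "x * y = q" "e * y = y" unfolding proj_def by blast
    have yt: "point y 1 \<odot>\<^bsub>Ind e V\<^esub> t \<in> N" using ND(4)[OF carrier_algebra t(1)] .
    have yt_nz: "point y 1 \<odot>\<^bsub>Ind e V\<^esub> t \<noteq> \<zero>\<^bsub>Ind e V\<^esub>"
      using q(2) smult_point_mult[OF ind.left_module_axioms tc, of x y]
        ind.smult_zero_right[OF carrier_algebra] xy(1) by metis
    obtain p where p: "\<And>t. t \<in> carrier (Ind e V) \<Longrightarrow> p t \<in> carrier V"
      "\<And>t. t \<in> carrier (Ind e V) \<Longrightarrow> iota (p (point e 1 \<odot>\<^bsub>Ind e V\<^esub> t)) = point e 1 \<odot>\<^bsub>Ind e V\<^esub> t"
      using iota_retraction by blast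
    define w where "w = p (point y 1 \<odot>\<^bsub>Ind e V\<^esub> t)"
    have yt_c: "point y 1 \<odot>\<^bsub>Ind e V\<^esub> t \<in> carrier (Ind e V)" using yt ND(1) by blast
    have e_yt: "point e 1 \<odot>\<^bsub>Ind e V\<^esub> (point y 1 \<odot>\<^bsub>Ind e V\<^esub> t) = point y 1 \<odot>\<^bsub>Ind e V\<^esub> t"
      using smult_point_mult[OF ind.left_module_axioms tc, of e y] xy(2) by simp
    have w: "w \<in> carrier V" "iota w = point y 1 \<odot>\<^bsub>Ind e V\<^esub> t"
      using p(1)[OF yt_c] p(2)[OF yt_c] e_yt by (simp_all add: w_def)
    \<comment> \<open>Pulling \<open>N\<close> back along \<open>iota\<close> gives a submodule of
      \<open>V\<close>; it contains \<open>w\<close>, which is nonzero, and is therefore all of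
      \<open>V\<close>.\<close>
    let ?W = "{v \<in> carrier V. iota v \<in> N}"
    have "submodule ?W (semigroup_algebra (Hclass e)) V"
      by (rule V.submoduleI)
        (use w yt ND(3) ND(4)[OF carrier_algebra] V.smult_closed in \<open>auto simp: iota_add iota_smult\<close>)
    moreover have "w \<in> ?W" "w \<noteq> \<zero>\<^bsub>V\<^esub>" using w yt yt_nz iota_zero by auto
    ultimately have "?W = carrier V"
      using simple unfolding simple_module_def by (metis (no_types, lifting) singletonD)
    then have iota_N: "iota v \<in> N" if "v \<in> carrier V" for v using that by auto
    have "s \<in> N" if "s \<in> carrier (Ind e V)" for s
      using that
      by (induction rule: Ind_induct) (use ND(3) ND(4)[OF carrier_algebra] iota_N in auto)
    then show ?thesis using ND(1) by blast
  qed
  then show "N = {\<zero>\<^bsub>Ind e V\<^esub>} \<or> N = carrier (Ind e V)" by blast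
qed

end

section \<open>Classification of the simple modules\<close>

context right_restriction_EI
begin

text \<open>The \<open>\<J>\<close>-class of \<open>e\<close> is the apex of \<open>M\<close> in the sense of Clifford, Munn and Ponizovskii.\<close>

definition apex :: "('s \<Rightarrow> 'k::field, 'm) module \<Rightarrow> 's \<Rightarrow> bool" where
  "apex M e \<longleftrightarrow> (\<exists>m\<in>carrier M. point e 1 \<odot>\<^bsub>M\<^esub> m \<noteq> \<zero>\<^bsub>M\<^esub>) \<and>
     (\<forall>a. \<forall>m\<in>carrier M. a * e = a \<longrightarrow> e * a = a \<longrightarrow> point a 1 \<odot>\<^bsub>M\<^esub> m \<noteq> \<zero>\<^bsub>M\<^esub> \<longrightarrow> a \<in> Hclass e)"

section \<open>Existence and transfer of the apex\<close>

lemma ex_apex: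
  fixes M :: "('s \<Rightarrow> 'k::field, 'm) module"
  assumes M: "left_module algebra M" and nz: "carrier M \<noteq> {\<zero>\<^bsub>M\<^esub>}"
  obtains f where "f \<in> E" "apex M f"
proof -
  interpret M: left_module algebra M by fact
  have zero: "point s 1 \<odot>\<^bsub>M\<^esub> \<zero>\<^bsub>M\<^esub> = \<zero>\<^bsub>M\<^esub>" for s
    by (rule M.smult_zero_right[OF carrier_algebra])
  let ?acts = "\<lambda>s. \<exists>m\<in>carrier M. point s 1 \<odot>\<^bsub>M\<^esub> m \<noteq> \<zero>\<^bsub>M\<^esub>"
  have acts_plus: "?acts (plus E s)" if s: "?acts s" for s
  proof -
    obtain m where m: "m \<in> carrier M" "point s 1 \<odot>\<^bsub>M\<^esub> m \<noteq> \<zero>\<^bsub>M\<^esub>" using s by blast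
    have "point (plus E s) 1 \<odot>\<^bsub>M\<^esub> (point s 1 \<odot>\<^bsub>M\<^esub> m) = point s 1 \<odot>\<^bsub>M\<^esub> m"
      using smult_point_mult[OF M m(1), of "plus E s" s] plus_mult[of s] by simp
    then show ?thesis using m M.smult_closed[OF carrier_algebra m(1)] by metis
  qed
  have acts_star: "?acts (star E s)" if s: "?acts s" for s
  proof -
    obtain m where m: "m \<in> carrier M" "point s 1 \<odot>\<^bsub>M\<^esub> m \<noteq> \<zero>\<^bsub>M\<^esub>" using s by blast
    have "point s 1 \<odot>\<^bsub>M\<^esub> (point (star E s) 1 \<odot>\<^bsub>M\<^esub> m) = point s 1 \<odot>\<^bsub>M\<^esub> m"
      using smult_point_mult[OF M m(1), of s "star E s"] mult_star[of s] by simp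
    then show ?thesis using m zero by metis
  qed
  have "\<exists>s. ?acts s"
  proof (rule ccontr)
    assume none: "\<not> (\<exists>s. ?acts s)"
    obtain m where m: "m \<in> carrier M" "m \<noteq> \<zero>\<^bsub>M\<^esub>" using nz M.M.zero_closed by auto
    have "\<one>\<^bsub>algebra\<^esub> \<odot>\<^bsub>M\<^esub> m = \<zero>\<^bsub>M\<^esub>"
      by (rule smult_eq_zeroI[OF M m(1), of _ UNIV]) (use none m in \<open>auto simp: funs_on_UNIV\<close>)
    then show False using m M.smult_one by simp
  qed
  then obtain f\<^sub>0 where "f\<^sub>0 \<in> E \<and> ?acts f\<^sub>0" using acts_plus plus_in by blast
  \<comment> \<open>Minimality in the natural order of \<open>E\<close> is reached by minimizing the
    number of elements of \<open>E\<close> below \<open>f\<close>.\<close>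
  then obtain f where f: "f \<in> E" "?acts f"
    and min: "\<And>g. g \<in> E \<and> ?acts g \<Longrightarrow> card {h \<in> E. h * f = h} \<le> card {h \<in> E. h * g = h}"
    using ex_has_least_nat[of "\<lambda>f. f \<in> E \<and> ?acts f" f\<^sub>0 "\<lambda>f. card {h \<in> E. h * f = h}"] by blast
  have minimal: "g = f" if g: "g \<in> E" "?acts g" "f * g = g" for g
  proof (rule ccontr)
    assume "g \<noteq> f"
    have gf: "g * f = g" using g f E_comm by metis
    then have "h * f = h" if "h * g = h" for h using that by (metis mult.assoc)
    moreover have "f * f = f" "f * g \<noteq> f" using E_idem f g(3) \<open>g \<noteq> f\<close> by auto
    ultimately have "{h \<in> E. h * g = h} \<subset> {h \<in> E. h * f = h}" using f(1) by blast
    then have "card {h \<in> E. h * g = h} < card {h \<in> E. h * f = h}" by (simp add: psubset_card_mono)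
    then show False using min[of g] g by simp
  qed
  \<comment> \<open>Both \<open>a\<^sup>+\<close> and \<open>a\<^sup>*\<close> lie below
    \<open>f\<close> and act nontrivially, so by minimality both equal \<open>f\<close> and
    \<open>a\<close> is an endomorphism of \<open>f\<close>.\<close>
  have "a \<in> Hclass f" if a: "a * f = a" "f * a = a" "?acts a" for a
  proof (rule endomorphism_in_Hclass)
    have "f * plus E a = plus E a" by (rule plus_mult_of_mult[OF f(1) a(2)])
    then show "plus E a = f" using minimal[OF plus_in acts_plus[OF a(3)]] by simp
    have "star E a * f = star E a" by (rule star_mult_of_mult[OF f(1) a(1)])
    then have "f * star E a = star E a" using E_comm[OF f(1) star_in] by simp
    then show "star E a = f" using minimal[OF star_in acts_star[OF a(3)]] by simp
  qed
  then have "apex M f" using f unfolding apex_def by blast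
  then show ?thesis using that f by blast
qed

text \<open>The elements \<open>x\<close> and \<open>y\<close> conjugate \<open>e S e\<close> to
  \<open>f S f\<close>, and \<open>a \<mapsto> x * a * y\<close> preserves nonzero action and
  reflects invertibility. This leads from the apex found in \<open>E\<close> to an arbitrary
  idempotent of its J-class.\<close>

lemma apex_transfer:
  fixes M :: "('s \<Rightarrow> 'k::field, 'm) module"
  assumes M: "left_module algebra M" and f: "f * f = f" and e: "e * e = e"
    and J: "ideal1 e = ideal1 f" and apex: "apex M f"
  shows "apex M e"
proof -
  interpret M: left_module algebra M by fact
  have zero: "point s 1 \<odot>\<^bsub>M\<^esub> \<zero>\<^bsub>M\<^esub> = \<zero>\<^bsub>M\<^esub>" for s
    by (rule M.smult_zero_right[OF carrier_algebra])
  have closed: "point s 1 \<odot>\<^bsub>M\<^esub> m \<in> carrier M" if "m \<in> carrier M" for s m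
    by (rule M.smult_closed[OF carrier_algebra that])
  obtain x y where xy: "x * y = f" "y * x = e" "f * x = x" "e * y = y"
    using J_equivalent_idempotentsE[OF e f J] by blast
  obtain m where m: "m \<in> carrier M" "point f 1 \<odot>\<^bsub>M\<^esub> m \<noteq> \<zero>\<^bsub>M\<^esub>"
    using apex unfolding apex_def by blast
  have "f = x * (e * y)" using xy by simp
  then have "point f 1 \<odot>\<^bsub>M\<^esub> m = point x 1 \<odot>\<^bsub>M\<^esub> (point e 1 \<odot>\<^bsub>M\<^esub> (point y 1 \<odot>\<^bsub>M\<^esub> m))"
    using smult_point_mult[OF M m(1), of x "e * y"] smult_point_mult[OF M m(1), of e y] by simp
  then have "point e 1 \<odot>\<^bsub>M\<^esub> (point y 1 \<odot>\<^bsub>M\<^esub> m) \<noteq> \<zero>\<^bsub>M\<^esub>" using m zero by metis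
  moreover have "a \<in> Hclass e"
    if m: "m \<in> carrier M" and a: "a * e = a" "e * a = a" and nz: "point a 1 \<odot>\<^bsub>M\<^esub> m \<noteq> \<zero>\<^bsub>M\<^esub>" for a m
  proof -
    define b where "b = x * a * y"
    have yb: "y * b = a * y" "b * x = x * a"
      unfolding b_def using xy a by (metis mult.assoc)+
    have "f * b = b" "b * f = b"
      unfolding b_def using xy a by (metis mult.assoc)+
    have "a = y * (b * x)" using yb xy a by (metis mult.assoc)
    then have "point a 1 \<odot>\<^bsub>M\<^esub> m = point y 1 \<odot>\<^bsub>M\<^esub> (point b 1 \<odot>\<^bsub>M\<^esub> (point x 1 \<odot>\<^bsub>M\<^esub> m))"
      using smult_point_mult[OF M m, of y "b * x"] smult_point_mult[OF M m, of b x] by simp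
    then have "point b 1 \<odot>\<^bsub>M\<^esub> (point x 1 \<odot>\<^bsub>M\<^esub> m) \<noteq> \<zero>\<^bsub>M\<^esub>" using nz zero by metis
    then have "b \<in> Hclass f"
      using apex \<open>f * b = b\<close> \<open>b * f = b\<close> closed[OF m] unfolding apex_def by blast
    then obtain w w' where w: "w * b = f" "b * w' = f" using Hclass_idempotent_iff[OF f] by blast
    have "(y * w * x) * a = y * (w * b) * x" using yb by (simp add: mult.assoc)
    then have "(y * w * x) * a = e" using w xy by (simp add: mult.assoc)
    moreover have "a * (y * w' * x) = y * (b * w') * x" using yb by (simp flip: mult.assoc)
    then have "a * (y * w' * x) = e" using w xy by (simp add: mult.assoc)
    ultimately show ?thesis using a Hclass_idempotent_iff[OF e] by blast
  qed
  ultimately show ?thesis unfolding apex_def using closed[OF m(1)] by blast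
qed

text \<open>Simplicity leads from the nonzero vector \<open>s m\<close> to one that \<open>e\<close>
  does not kill, so some \<open>e * (t * s)\<close> acts nontrivially. It lies in
  \<open>e S e\<close>, hence in \<open>G\<^sub>e\<close>, and its inverse yields a left inverse of
  \<open>s\<close>.\<close>

lemma apex_acts_imp_Lclass:
  fixes M :: "('s \<Rightarrow> 'k::field, 'm) module"
  assumes simple: "simple_module algebra M" and e: "e * e = e" and apex: "apex M e"
    and s: "s * e = s" and m: "m \<in> carrier M" and nz: "point s 1 \<odot>\<^bsub>M\<^esub> m \<noteq> \<zero>\<^bsub>M\<^esub>"
  shows "s \<in> Lclass e"
proof -
  have M: "left_module algebra M" using simple by (simp add: simple_module_def)
  interpret M: left_module algebra M by fact
  obtain m\<^sub>0 where m\<^sub>0: "m\<^sub>0 \<in> carrier M" "point e 1 \<odot>\<^bsub>M\<^esub> m\<^sub>0 \<noteq> \<zero>\<^bsub>M\<^esub>"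
    using apex unfolding apex_def by blast
  obtain a where a: "m\<^sub>0 = a \<odot>\<^bsub>M\<^esub> (point s 1 \<odot>\<^bsub>M\<^esub> m)"
  proof (rule M.cyclic_eq_carrier[OF _ _ nz m\<^sub>0(1)])
    show "N = {\<zero>\<^bsub>M\<^esub>} \<or> N = carrier M" if "submodule N algebra M" for N
      using simple that by (simp add: simple_module_def)
    show "point s 1 \<odot>\<^bsub>M\<^esub> m \<in> carrier M" by (rule M.smult_closed[OF carrier_algebra m])
  qed blast
  let ?b = "convolution (point e 1) (convolution a (point s 1))"
  have b: "?b \<odot>\<^bsub>M\<^esub> m \<noteq> \<zero>\<^bsub>M\<^esub>"
    using m\<^sub>0(2) unfolding a by (simp add: smult_convolution[OF M] m M.smult_closed[OF carrier_algebra])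
  have "?b \<in> funs_on {e * (t * s) |t. True}"
    by (rule convolution_in_funs_on[of _ "{e}" _ "{t * s |t. True}"])
      (auto intro!: point_in_funs_on convolution_in_funs_on[of a UNIV _ "{s}"] simp: funs_on_UNIV)
  then have "\<exists>t. point (e * (t * s)) 1 \<odot>\<^bsub>M\<^esub> m \<noteq> \<zero>\<^bsub>M\<^esub>"
    using smult_eq_zeroI[OF M m, of ?b "{e * (t * s) |t. True}"] b by blast
  then obtain t where t: "point (e * (t * s)) 1 \<odot>\<^bsub>M\<^esub> m \<noteq> \<zero>\<^bsub>M\<^esub>" by blast
  have "e * (t * s) * e = e * (t * s)" "e * (e * (t * s)) = e * (t * s)"
    using e s by (simp_all add: mult.assoc) (simp flip: mult.assoc)
  then have "e * (t * s) \<in> Hclass e" using apex m t unfolding apex_def by blast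
  then obtain w where "w * (e * (t * s)) = e" using Hclass_idempotent_iff[OF e] by blast
  then have "(w * e * t) * s = e" by (simp add: mult.assoc)
  then show ?thesis using s Lclass_idempotent_iff[OF e] by blast
qed

text \<open>The space \<open>e M\<close>, described as the fixed vectors of \<open>e\<close>, which
  is the same for an idempotent. It is regarded as a module over the algebra of
  \<open>G\<^sub>e\<close>.\<close>

definition corner :: "('s \<Rightarrow> 'k::field, 'm) module \<Rightarrow> 's \<Rightarrow> ('s \<Rightarrow> 'k, 'm) module" where
  "corner M e = M\<lparr>carrier := {m \<in> carrier M. point e 1 \<odot>\<^bsub>M\<^esub> m = m}\<rparr>"

lemma corner_simps:
  "carrier (corner M e) = {m \<in> carrier M. point e 1 \<odot>\<^bsub>M\<^esub> m = m}"
  "x \<oplus>\<^bsub>corner M e\<^esub> y = x \<oplus>\<^bsub>M\<^esub> y"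
  "\<zero>\<^bsub>corner M e\<^esub> = \<zero>\<^bsub>M\<^esub>"
  "a \<odot>\<^bsub>corner M e\<^esub> x = a \<odot>\<^bsub>M\<^esub> x"
  by (simp_all add: corner_def)

lemma left_module_corner:
  fixes M :: "('s \<Rightarrow> 'k::field, 'm) module"
  assumes M: "left_module algebra M" and e: "e * e = e"
  shows "left_module (semigroup_algebra (Hclass e)) (corner M e)"
proof (rule left_moduleI)
  interpret M: left_module algebra M by fact
  show "ring (semigroup_algebra (Hclass e) :: ('s \<Rightarrow> 'k) ring)" by (rule ring_group_algebra[OF e])
  show "abelian_group (corner M e)"
  proof (rule abelian_groupI)
    fix x assume "x \<in> carrier (corner M e)"
    then have x: "x \<in> carrier M" "point e 1 \<odot>\<^bsub>M\<^esub> x = x" by (simp_all add: corner_simps)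
    have "\<ominus>\<^bsub>M\<^esub> x \<oplus>\<^bsub>M\<^esub> x = \<zero>\<^bsub>M\<^esub>" using x by (simp add: M.M.l_neg)
    moreover have "point e 1 \<odot>\<^bsub>M\<^esub> (\<ominus>\<^bsub>M\<^esub> x) = \<ominus>\<^bsub>M\<^esub> x"
    proof -
      have "point e 1 \<odot>\<^bsub>M\<^esub> (\<ominus>\<^bsub>M\<^esub> x) \<oplus>\<^bsub>M\<^esub> x = point e 1 \<odot>\<^bsub>M\<^esub> (\<ominus>\<^bsub>M\<^esub> x \<oplus>\<^bsub>M\<^esub> x)"
        using x M.smult_r_distr[OF carrier_algebra, of "\<ominus>\<^bsub>M\<^esub> x" x "point e 1"] by simp
      also have "\<dots> = \<zero>\<^bsub>M\<^esub>"
        using x by (simp add: M.M.l_neg M.smult_zero_right[OF carrier_algebra])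
      finally show ?thesis
        using x M.M.minus_equality M.smult_closed[OF carrier_algebra] M.M.a_inv_closed by metis
    qed
    ultimately show "\<exists>y\<in>carrier (corner M e). y \<oplus>\<^bsub>corner M e\<^esub> x = \<zero>\<^bsub>corner M e\<^esub>"
      using x by (auto simp: corner_simps)
  qed (auto simp: corner_simps M.M.a_ac M.smult_r_distr[OF carrier_algebra]
      M.smult_zero_right[OF carrier_algebra])
  fix a b :: "'s \<Rightarrow> 'k" and x y
  show "(a \<oplus>\<^bsub>semigroup_algebra (Hclass e)\<^esub> b) \<odot>\<^bsub>corner M e\<^esub> x =
      a \<odot>\<^bsub>corner M e\<^esub> x \<oplus>\<^bsub>corner M e\<^esub> b \<odot>\<^bsub>corner M e\<^esub> x" if "x \<in> carrier (corner M e)"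
    using that M.smult_l_distr[OF carrier_algebra carrier_algebra, of x a b]
    by (simp add: corner_simps semigroup_algebra_simps)
  show "(a \<otimes>\<^bsub>semigroup_algebra (Hclass e)\<^esub> b) \<odot>\<^bsub>corner M e\<^esub> x =
      a \<odot>\<^bsub>corner M e\<^esub> (b \<odot>\<^bsub>corner M e\<^esub> x)" if "x \<in> carrier (corner M e)"
    using that smult_convolution[OF M, of x a b] by (simp add: corner_simps semigroup_algebra_simps)
  show "a \<odot>\<^bsub>corner M e\<^esub> (x \<oplus>\<^bsub>corner M e\<^esub> y) = a \<odot>\<^bsub>corner M e\<^esub> x \<oplus>\<^bsub>corner M e\<^esub> a \<odot>\<^bsub>corner M e\<^esub> y"
    if "x \<in> carrier (corner M e)" "y \<in> carrier (corner M e)"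
    using that M.smult_r_distr[OF carrier_algebra] by (simp add: corner_simps)
  show "a \<odot>\<^bsub>corner M e\<^esub> x \<in> carrier (corner M e)"
    if "a \<in> carrier (semigroup_algebra (Hclass e))" "x \<in> carrier (corner M e)"
  proof -
    have "convolution (point e 1) a = a"
      using that group_algebra_unit[OF e, of a] by (simp add: semigroup_algebra_simps)
    then show ?thesis
      using that smult_convolution[OF M, of x "point e 1" a] M.smult_closed[OF carrier_algebra]
      by (simp add: corner_simps)
  qed
  show "\<one>\<^bsub>semigroup_algebra (Hclass e)\<^esub> \<odot>\<^bsub>corner M e\<^esub> x = x" if "x \<in> carrier (corner M e)"
    using that by (simp add: one_group_algebra[OF e] corner_simps)
qed

lemma corner_nonzero:
  assumes M: "left_module algebra M" and e: "e * e = e" and apex: "apex M e"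
  obtains v where "v \<in> carrier (corner M e)" "v \<noteq> \<zero>\<^bsub>M\<^esub>"
proof -
  obtain m where m: "m \<in> carrier M" "point e 1 \<odot>\<^bsub>M\<^esub> m \<noteq> \<zero>\<^bsub>M\<^esub>"
    using apex unfolding apex_def by blast
  have "point e 1 \<odot>\<^bsub>M\<^esub> m \<in> carrier (corner M e)"
    using smult_point_mult[OF M m(1), of e e] e m left_module.smult_closed[OF M carrier_algebra]
    by (simp add: corner_simps)
  then show ?thesis using that m by blast
qed

text \<open>If \<open>n\<close> and \<open>v\<close> lie in \<open>e M\<close> and
  \<open>v = a n\<close>, then also \<open>v = (e a e) n\<close>. The apex property kills the part
  of \<open>e a e\<close> outside \<open>G\<^sub>e\<close>, so a nonzero \<open>n\<close> already
  generates \<open>e M\<close> over the group algebra.\<close>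

lemma simple_corner:
  fixes M :: "('s \<Rightarrow> 'k::field, 'm) module"
  assumes simple: "simple_module algebra M" and e: "e * e = e" and apex: "apex M e"
  shows "simple_module (semigroup_algebra (Hclass e)) (corner M e)"
proof (rule simple_moduleI)
  have M: "left_module algebra M" using simple by (simp add: simple_module_def)
  interpret M: left_module algebra M by fact
  show "left_module (semigroup_algebra (Hclass e)) (corner M e)"
    by (rule left_module_corner[OF M e])
  obtain v where "v \<in> carrier (corner M e)" "v \<noteq> \<zero>\<^bsub>M\<^esub>" by (rule corner_nonzero[OF M e apex])
  then show "carrier (corner M e) \<noteq> {\<zero>\<^bsub>corner M e\<^esub>}" by (auto simp: corner_simps(3))
  fix N assume N: "submodule N (semigroup_algebra (Hclass e)) (corner M e)"
  note ND = submoduleD[OF N]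
  have "N = carrier (corner M e)" if "N \<noteq> {\<zero>\<^bsub>M\<^esub>}"
  proof
    show "N \<subseteq> carrier (corner M e)" by (rule ND(1))
    have "\<not> N \<subseteq> {\<zero>\<^bsub>M\<^esub>}" using that ND(2) by (auto simp: corner_simps)
    then obtain n where n: "n \<in> N" "n \<noteq> \<zero>\<^bsub>M\<^esub>" by auto
    then have nM: "n \<in> carrier M" "point e 1 \<odot>\<^bsub>M\<^esub> n = n" using ND(1) by (auto simp: corner_simps)
    show "carrier (corner M e) \<subseteq> N"
    proof
      fix v assume "v \<in> carrier (corner M e)"
      then have v: "v \<in> carrier M" "point e 1 \<odot>\<^bsub>M\<^esub> v = v" by (simp_all add: corner_simps)
      obtain a where a: "v = a \<odot>\<^bsub>M\<^esub> n"
      proof (rule M.cyclic_eq_carrier[OF _ nM(1) n(2) v(1)])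
        show "N = {\<zero>\<^bsub>M\<^esub>} \<or> N = carrier M" if "submodule N algebra M" for N
          using simple that by (simp add: simple_module_def)
      qed blast
      define b where "b = convolution (point e 1) (convolution a (point e 1))"
      have "b \<odot>\<^bsub>M\<^esub> n = point e 1 \<odot>\<^bsub>M\<^esub> (a \<odot>\<^bsub>M\<^esub> (point e 1 \<odot>\<^bsub>M\<^esub> n))"
        unfolding b_def using nM(1) by (simp add: smult_convolution[OF M])
      then have bn: "b \<odot>\<^bsub>M\<^esub> n = v" using nM v a by simp
      have "b \<in> funs_on {s. s * e = s \<and> e * s = s}"
        unfolding b_def
      proof (rule convolution_in_funs_on[of _ "{e}" _ "{s. s * e = s}"])
        show "convolution a (point e 1) \<in> funs_on {s. s * e = s}"
          by (rule convolution_in_funs_on[of a UNIV _ "{e}"])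
            (use e in \<open>auto simp: funs_on_UNIV point_in_funs_on mult.assoc\<close>)
      qed (use e in \<open>auto simp: point_in_funs_on mult.assoc simp flip: mult.assoc[of e e]\<close>)
      then have "restr (- Hclass e) b \<in> funs_on {s. s * e = s \<and> e * s = s \<and> s \<notin> Hclass e}"
        by (auto simp: funs_on_def restr_def)
      then have zero: "restr (- Hclass e) b \<odot>\<^bsub>M\<^esub> n = \<zero>\<^bsub>M\<^esub>"
        by (rule smult_eq_zeroI[OF M nM(1)]) (use apex nM(1) in \<open>auto simp: apex_def\<close>)
      have split: "b = (\<lambda>s. restr (Hclass e) b s + restr (- Hclass e) b s)"
        by (auto simp: restr_def)
      have "v = restr (Hclass e) b \<odot>\<^bsub>M\<^esub> n \<oplus>\<^bsub>M\<^esub> restr (- Hclass e) b \<odot>\<^bsub>M\<^esub> n"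
        using M.smult_l_distr[OF carrier_algebra carrier_algebra nM(1), of "restr (Hclass e) b" "restr (- Hclass e) b"]
        by (simp add: semigroup_algebra_simps bn flip: split)
      then have "v = restr (Hclass e) b \<odot>\<^bsub>M\<^esub> n"
        using zero M.smult_closed[OF carrier_algebra nM(1)] by simp
      then show "v \<in> N"
        using ND(4)[OF _ n(1), of "restr (Hclass e) b"]
        by (simp add: corner_simps semigroup_algebra_simps restr_in_funs_on)
    qed
  qed
  then show "N = {\<zero>\<^bsub>corner M e\<^esub>} \<or> N = carrier (corner M e)" by (auto simp: corner_simps(3))
qed

lemma isomorphic_Ind_corner:
  fixes M :: "('s \<Rightarrow> 'k::field, 'm) module"
  assumes simple: "simple_module algebra M" and e: "e * e = e" and apex: "apex M e"
  shows "module_isomorphic algebra M (Ind e (corner M e))"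
proof -
  have M: "left_module algebra M" using simple by (simp add: simple_module_def)
  interpret M: left_module algebra M by fact
  interpret I: induction_data E e "corner M e"
    by (intro induction_data.intro induction_data_axioms.intro right_restriction_EI_axioms e left_module_corner[OF M e])
  obtain h where h: "\<And>t. t \<in> carrier (Ind e (corner M e)) \<Longrightarrow> h t \<in> carrier M"
    and h_add: "\<And>s t. s \<in> carrier (Ind e (corner M e)) \<Longrightarrow> t \<in> carrier (Ind e (corner M e)) \<Longrightarrow>
      h (s \<oplus>\<^bsub>Ind e (corner M e)\<^esub> t) = h s \<oplus>\<^bsub>M\<^esub> h t"
    and h_tens: "\<And>f v. f \<in> carrier (L_bimodule e) \<Longrightarrow> v \<in> carrier (corner M e) \<Longrightarrow>
      h (I.ten.tens f v) = f \<odot>\<^bsub>M\<^esub> v"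
    unfolding I.Ind_eq
  proof (rule I.ten.tensor_universal[OF M.M.abelian_group_axioms, of "\<lambda>f v. f \<odot>\<^bsub>M\<^esub> v"])
    fix f g :: "'s \<Rightarrow> 'k" and v assume v: "v \<in> carrier (corner M e)"
    show "f \<odot>\<^bsub>M\<^esub> v \<in> carrier M" using v M.smult_closed[OF carrier_algebra] by (simp add: corner_simps)
    show "(f \<oplus>\<^bsub>L_bimodule e\<^esub> g) \<odot>\<^bsub>M\<^esub> v = f \<odot>\<^bsub>M\<^esub> v \<oplus>\<^bsub>M\<^esub> g \<odot>\<^bsub>M\<^esub> v"
      using v M.smult_l_distr[OF carrier_algebra carrier_algebra, of v f g]
      by (simp add: corner_simps L_bimodule_simps semigroup_algebra_simps)
    show "rsmult (L_bimodule e) f g \<odot>\<^bsub>M\<^esub> v = f \<odot>\<^bsub>M\<^esub> (g \<odot>\<^bsub>corner M e\<^esub> v)"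
      using v smult_convolution[OF M, of v f g] by (simp add: corner_simps L_bimodule_simps)
    show "f \<odot>\<^bsub>M\<^esub> (v \<oplus>\<^bsub>corner M e\<^esub> w) = f \<odot>\<^bsub>M\<^esub> v \<oplus>\<^bsub>M\<^esub> f \<odot>\<^bsub>M\<^esub> w" if "w \<in> carrier (corner M e)" for w
      using v that M.smult_r_distr[OF carrier_algebra] by (simp add: corner_simps)
  qed blast
  \<comment> \<open>Elements of \<open>S e\<close> outside \<open>\<L>(e)\<close> annihilate
    \<open>M\<close> by \<open>apex_acts_imp_Lclass\<close>. So the truncated action on the induced
    module agrees with the full action on \<open>M\<close>, which is what makes \<open>h\<close>
    linear.\<close>
  have h_smult_iota: "h (f \<odot>\<^bsub>Ind e (corner M e)\<^esub> I.iota v) = f \<odot>\<^bsub>M\<^esub> v"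
    if f: "f \<in> funs_on {s. s * e = s}" and v: "v \<in> carrier (corner M e)" for f v
  proof -
    have vM: "v \<in> carrier M" using v by (simp add: corner_simps)
    have "restr (- Lclass e) f \<in> funs_on {s. s * e = s \<and> s \<notin> Lclass e}"
      using f by (auto simp: funs_on_def restr_def)
    then have zero: "restr (- Lclass e) f \<odot>\<^bsub>M\<^esub> v = \<zero>\<^bsub>M\<^esub>"
      by (rule smult_eq_zeroI[OF M vM]) (use apex_acts_imp_Lclass[OF simple e apex _ vM] in auto)
    have split: "f = (\<lambda>s. restr (Lclass e) f s + restr (- Lclass e) f s)"
      by (auto simp: restr_def)
    have "f \<odot>\<^bsub>M\<^esub> v = restr (Lclass e) f \<odot>\<^bsub>M\<^esub> v \<oplus>\<^bsub>M\<^esub> restr (- Lclass e) f \<odot>\<^bsub>M\<^esub> v"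
      using M.smult_l_distr[OF carrier_algebra carrier_algebra vM, of "restr (Lclass e) f" "restr (- Lclass e) f"]
      by (simp add: semigroup_algebra_simps flip: split)
    then have "f \<odot>\<^bsub>M\<^esub> v = restr (Lclass e) f \<odot>\<^bsub>M\<^esub> v"
      using zero M.smult_closed[OF carrier_algebra vM] by simp
    then show ?thesis
      using h_tens[OF _ v, of "restr (Lclass e) f"] I.smult_iota[OF f v]
      by (simp add: L_bimodule_simps restr_in_funs_on)
  qed
  have h_lin: "h (a \<odot>\<^bsub>Ind e (corner M e)\<^esub> t) = a \<odot>\<^bsub>M\<^esub> h t" if "t \<in> carrier (Ind e (corner M e))" for a t
    using that
  proof (induction rule: I.Ind_induct)
    case (point x v)
    have x: "x * e = x" using point(1) I.Lclass_subset by blast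
    have vM: "v \<in> carrier M" using point(2) by (simp add: corner_simps)
    have "convolution a (point x 1) \<in> funs_on {s. s * e = s}"
      by (rule convolution_in_funs_on[of a UNIV _ "{x}"])
        (use x in \<open>auto simp: funs_on_UNIV point_in_funs_on mult.assoc\<close>)
    from h_smult_iota[OF this point(2)] show ?case
      using x h_smult_iota[OF point_in_funs_on point(2), of x 1]
      by (simp add: smult_convolution[OF M vM]
          smult_convolution[OF I.ind.left_module_axioms I.iota_closed[OF point(2)]])
  next
    case (add s t)
    then show ?case
      using I.ind.smult_r_distr[OF carrier_algebra, of s t a] I.ind.smult_closed[OF carrier_algebra]
        M.smult_r_distr[OF carrier_algebra] by (simp add: h h_add)
  qed
  obtain v where v: "v \<in> carrier (corner M e)" "v \<noteq> \<zero>\<^bsub>M\<^esub>" by (rule corner_nonzero[OF M e apex])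
  have "point e 1 \<in> funs_on {s. s * e = s}" using e by (simp add: point_in_funs_on)
  from h_smult_iota[OF this v(1)] have "h (I.iota v) = v"
    using v I.point_e_iota[OF v(1)] by (simp add: corner_simps)
  \<comment> \<open>Schur's lemma applies because \<open>h\<close> sends \<open>I.iota v\<close> to
    the nonzero vector \<open>v\<close>.\<close>
  then have "bij_betw h (carrier (Ind e (corner M e))) (carrier M)"
    using v by (intro schur[OF I.simple_Ind[OF simple_corner[OF simple e apex]] simple h h_add h_lin
          I.iota_closed[OF v(1)]]) simp_all
  then have "module_isomorphic algebra (Ind e (corner M e)) M"
    using h_add h_lin unfolding module_isomorphic_def by blast
  then show ?thesis by (rule module_isomorphic_sym[OF I.ind.left_module_axioms])
qed

text \<open>The idempotent \<open>e\<close> fixes a nonzero vector of the first module, hence acts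
  nontrivially on the second, and \<open>nonzero_action_ideal1\<close> bounds its ideal from
  below.\<close>

lemma Ind_isomorphic_ideal1:
  fixes V :: "('s \<Rightarrow> 'k::field, 'v) module" and V' :: "('s \<Rightarrow> 'k, 'w) module"
  assumes e: "e * e = e" and V: "left_module (semigroup_algebra (Hclass e)) V" "carrier V \<noteq> {\<zero>\<^bsub>V\<^esub>}"
    and e': "e' * e' = e'" and V': "left_module (semigroup_algebra (Hclass e')) V'"
    and iso: "module_isomorphic algebra (Ind e V) (Ind e' V')"
  shows "ideal1 e' \<subseteq> ideal1 e"
proof -
  interpret I: induction_data E e V
    by (intro induction_data.intro induction_data_axioms.intro right_restriction_EI_axioms e V)
  interpret I': induction_data E e' V'
    by (intro induction_data.intro induction_data_axioms.intro right_restriction_EI_axioms e' V')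
  obtain h where bij: "bij_betw h (carrier (Ind e V)) (carrier (Ind e' V'))"
    and add: "\<And>x y. x \<in> carrier (Ind e V) \<Longrightarrow> y \<in> carrier (Ind e V) \<Longrightarrow>
      h (x \<oplus>\<^bsub>Ind e V\<^esub> y) = h x \<oplus>\<^bsub>Ind e' V'\<^esub> h y"
    and lin: "\<And>a x. a \<in> carrier algebra \<Longrightarrow> x \<in> carrier (Ind e V) \<Longrightarrow>
      h (a \<odot>\<^bsub>Ind e V\<^esub> x) = a \<odot>\<^bsub>Ind e' V'\<^esub> h x"
    using iso unfolding module_isomorphic_def by blast
  have h: "h x \<in> carrier (Ind e' V')" if "x \<in> carrier (Ind e V)" for x
    using bij that by (rule bij_betw_apply)
  obtain v where v: "v \<in> carrier V" "I.iota v \<noteq> \<zero>\<^bsub>Ind e V\<^esub>" by (rule I.Ind_nonzero[OF V(2)])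
  have "h \<zero>\<^bsub>Ind e V\<^esub> = \<zero>\<^bsub>Ind e' V'\<^esub>"
    by (rule additive_zero[OF I.ind.M.abelian_group_axioms I'.ind.M.abelian_group_axioms h add])
  then have "h (I.iota v) \<noteq> \<zero>\<^bsub>Ind e' V'\<^esub>"
    using v I.iota_closed[OF v(1)] bij_betw_imp_inj_on[OF bij] I.ind.M.zero_closed by (metis inj_on_eq_iff)
  moreover have "point e 1 \<odot>\<^bsub>Ind e' V'\<^esub> h (I.iota v) = h (I.iota v)"
    using lin[OF carrier_algebra I.iota_closed[OF v(1)], of "point e 1"] I.point_e_iota[OF v(1)] by simp
  ultimately show ?thesis
    using I'.nonzero_action_ideal1[OF h[OF I.iota_closed[OF v(1)]], of e] by simp
qed

text \<open>An isomorphism commutes with the action of \<open>e\<close> and so restricts to the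
  spaces \<open>e Ind(V)\<close> and \<open>e Ind(V')\<close>, which are copies of \<open>V\<close>
  and \<open>V'\<close> under the two maps \<open>iota\<close>.\<close>

lemma Ind_isomorphic_imp_isomorphic:
  fixes V :: "('s \<Rightarrow> 'k::field, 'v) module" and V' :: "('s \<Rightarrow> 'k, 'w) module"
  assumes e: "e * e = e" and V: "left_module (semigroup_algebra (Hclass e)) V"
    and V': "left_module (semigroup_algebra (Hclass e)) V'"
    and iso: "module_isomorphic algebra (Ind e V) (Ind e V')"
  shows "module_isomorphic (semigroup_algebra (Hclass e)) V V'"
proof -
  interpret I: induction_data E e V
    by (intro induction_data.intro induction_data_axioms.intro right_restriction_EI_axioms e V)
  interpret I': induction_data E e V'
    by (intro induction_data.intro induction_data_axioms.intro right_restriction_EI_axioms e V')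
  obtain h where bij: "bij_betw h (carrier (Ind e V)) (carrier (Ind e V'))"
    and add: "\<And>x y. x \<in> carrier (Ind e V) \<Longrightarrow> y \<in> carrier (Ind e V) \<Longrightarrow>
      h (x \<oplus>\<^bsub>Ind e V\<^esub> y) = h x \<oplus>\<^bsub>Ind e V'\<^esub> h y"
    and lin: "\<And>a x. a \<in> carrier algebra \<Longrightarrow> x \<in> carrier (Ind e V) \<Longrightarrow>
      h (a \<odot>\<^bsub>Ind e V\<^esub> x) = a \<odot>\<^bsub>Ind e V'\<^esub> h x"
    using iso unfolding module_isomorphic_def by blast
  have h: "h x \<in> carrier (Ind e V')" if "x \<in> carrier (Ind e V)" for x
    using bij that by (rule bij_betw_apply)
  note inj = inj_onD[OF bij_betw_imp_inj_on[OF bij]]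
  obtain p where p: "\<And>t. t \<in> carrier (Ind e V) \<Longrightarrow> p t \<in> carrier V"
    "\<And>v. v \<in> carrier V \<Longrightarrow> p (I.iota v) = v"
    "\<And>t. t \<in> carrier (Ind e V) \<Longrightarrow> I.iota (p (point e 1 \<odot>\<^bsub>Ind e V\<^esub> t)) = point e 1 \<odot>\<^bsub>Ind e V\<^esub> t"
    using I.iota_retraction by blast
  obtain p' where p': "\<And>t. t \<in> carrier (Ind e V') \<Longrightarrow> p' t \<in> carrier V'"
    "\<And>v. v \<in> carrier V' \<Longrightarrow> p' (I'.iota v) = v"
    "\<And>t. t \<in> carrier (Ind e V') \<Longrightarrow> I'.iota (p' (point e 1 \<odot>\<^bsub>Ind e V'\<^esub> t)) = point e 1 \<odot>\<^bsub>Ind e V'\<^esub> t"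
    using I'.iota_retraction by blast
  define k where "k = (\<lambda>v. p' (h (I.iota v)))"
  have k_closed: "k v \<in> carrier V'" if "v \<in> carrier V" for v
    unfolding k_def by (rule p'(1)[OF h[OF I.iota_closed[OF that]]])
  have iota_k: "I'.iota (k v) = h (I.iota v)" if v: "v \<in> carrier V" for v
  proof -
    have "point e 1 \<odot>\<^bsub>Ind e V'\<^esub> h (I.iota v) = h (I.iota v)"
      using lin[OF carrier_algebra I.iota_closed[OF v], of "point e 1"] I.point_e_iota[OF v] by simp
    then show ?thesis using p'(3)[OF h[OF I.iota_closed[OF v]]] by (simp add: k_def)
  qed
  \<comment> \<open>Identities for \<open>k\<close> are verified after applying \<open>iota\<close>,
    where they become identities for \<open>h\<close>.\<close>
  have k_eqI: "k v = w" if "v \<in> carrier V" "w \<in> carrier V'" "h (I.iota v) = I'.iota w" for v w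
    using that p'(2) by (simp add: k_def)
  have "inj_on k (carrier V)"
  proof (rule inj_onI)
    fix v w assume vw: "v \<in> carrier V" "w \<in> carrier V" "k v = k w"
    then have "h (I.iota v) = h (I.iota w)" using iota_k by metis
    then have "I.iota v = I.iota w" using inj I.iota_closed vw by blast
    then show "v = w" using p(2) vw by metis
  qed
  moreover have "k ` carrier V = carrier V'"
  proof
    show "k ` carrier V \<subseteq> carrier V'" using k_closed by blast
    show "carrier V' \<subseteq> k ` carrier V"
    proof
      fix w assume w: "w \<in> carrier V'"
      have "I'.iota w \<in> h ` carrier (Ind e V)"
        using bij_betw_imp_surj_on[OF bij] I'.iota_closed[OF w] by simp
      then obtain t where t: "t \<in> carrier (Ind e V)" "h t = I'.iota w" by auto
      have et: "point e 1 \<odot>\<^bsub>Ind e V\<^esub> t \<in> carrier (Ind e V)" by (rule I.ind.smult_closed[OF carrier_algebra t(1)])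
      have "h (point e 1 \<odot>\<^bsub>Ind e V\<^esub> t) = h t"
        using lin[OF carrier_algebra t(1), of "point e 1"] t(2) I'.point_e_iota[OF w] by simp
      \<comment> \<open>Injectivity of \<open>h\<close> shows that the preimage \<open>t\<close> is
        fixed by \<open>e\<close>, so it comes from a vector of \<open>V\<close>.\<close>
      then have "point e 1 \<odot>\<^bsub>Ind e V\<^esub> t = t" using inj et t(1) by blast
      then have "I.iota (p t) = t" using p(3)[OF t(1)] by simp
      then have "k (p t) = w" using k_eqI[OF p(1)[OF t(1)] w] t(2) by simp
      then show "w \<in> k ` carrier V" using p(1)[OF t(1)] by blast
    qed
  qed
  moreover have "k (v \<oplus>\<^bsub>V\<^esub> w) = k v \<oplus>\<^bsub>V'\<^esub> k w" if "v \<in> carrier V" "w \<in> carrier V" for v w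
    by (rule k_eqI)
      (use that in \<open>simp_all add: k_closed I.iota_add I'.iota_add I.iota_closed add iota_k\<close>)
  moreover have "k (g \<odot>\<^bsub>V\<^esub> v) = g \<odot>\<^bsub>V'\<^esub> k v"
    if "g \<in> carrier (semigroup_algebra (Hclass e))" "v \<in> carrier V" for g v
    by (rule k_eqI)
      (use that in \<open>simp_all add: k_closed I.V.smult_closed I'.V.smult_closed I.iota_smult I'.iota_smult
         I.iota_closed lin carrier_algebra iota_k\<close>)
  ultimately show ?thesis unfolding module_isomorphic_def bij_betw_def by blast
qed

end

theorem theorem4p3:
  fixes E :: "'s::{semigroup_mult,finite} set"
    and idem_of :: "'s set \<Rightarrow> 's"
  assumes "right_restriction E"
    and "EI_Ehresmann E"
    and "\<And>J. regular_Jclass J \<Longrightarrow> idem_of J \<in> J \<and> idem_of J * idem_of J = idem_of J"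
  shows
    "(\<forall>J (V :: ('s \<Rightarrow> 'k::field, 'v) module).
        regular_Jclass J \<and> simple_module (semigroup_algebra (Hclass (idem_of J))) V \<longrightarrow>
        simple_module (semigroup_algebra UNIV) (Ind (idem_of J) V)) \<and>
     (\<forall>M :: ('s \<Rightarrow> 'k, 'm) module.
        simple_module (semigroup_algebra UNIV) M \<longrightarrow>
        (\<exists>J (V :: ('s \<Rightarrow> 'k, 'm) module).
           regular_Jclass J \<and> simple_module (semigroup_algebra (Hclass (idem_of J))) V \<and>
           module_isomorphic (semigroup_algebra UNIV) M (Ind (idem_of J) V))) \<and>
     (\<forall>J J' (V :: ('s \<Rightarrow> 'k, 'v) module) (V' :: ('s \<Rightarrow> 'k, 'w) module).
        regular_Jclass J \<and> simple_module (semigroup_algebra (Hclass (idem_of J))) V \<and>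
        regular_Jclass J' \<and> simple_module (semigroup_algebra (Hclass (idem_of J'))) V' \<and>
        module_isomorphic (semigroup_algebra UNIV) (Ind (idem_of J) V) (Ind (idem_of J') V') \<longrightarrow>
        J = J' \<and> module_isomorphic (semigroup_algebra (Hclass (idem_of J))) V V')"
proof (intro conjI allI impI)
  interpret right_restriction_EI E using assms(1,2) by unfold_locales
  {
    fix J and V :: "('s \<Rightarrow> 'k, 'v) module"
    assume *: "regular_Jclass J \<and> simple_module (semigroup_algebra (Hclass (idem_of J))) V"
    then have e: "idem_of J * idem_of J = idem_of J"
      and V: "left_module (semigroup_algebra (Hclass (idem_of J))) V"
      using assms(3) by (simp_all add: simple_module_def)
    interpret induction_data E "idem_of J" V
      by (intro induction_data.intro induction_data_axioms.intro right_restriction_EI_axioms e V)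
    show "simple_module (semigroup_algebra UNIV) (Ind (idem_of J) V)"
      using * by (simp add: simple_Ind)
  next
    fix M :: "('s \<Rightarrow> 'k, 'm) module"
    assume simple: "simple_module (semigroup_algebra UNIV) M"
    then have M: "left_module algebra M" "carrier M \<noteq> {\<zero>\<^bsub>M\<^esub>}" by (simp_all add: simple_module_def)
    obtain f where f: "f \<in> E" "apex M f" by (rule ex_apex[OF M])
    have "f * f * f = f" using E_idem[OF f(1)] by simp
    then have "regular_element f" "f \<in> Jclass f" by (auto simp: regular_element_def Jclass_def)
    then have J: "regular_Jclass (Jclass f)" unfolding regular_Jclass_def by blast
    let ?e = "idem_of (Jclass f)"
    have e: "?e * ?e = ?e" "ideal1 ?e = ideal1 f" using assms(3)[OF J] by (simp_all add: Jclass_def)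
    then have apex: "apex M ?e" using apex_transfer[OF M(1) E_idem[OF f(1)] _ _ f(2)] by blast
    \<comment> \<open>The witness is \<open>corner M ?e\<close>, whose carrier is a subset of that
      of \<open>M\<close>; hence \<open>V\<close> may be taken over the same vector type.\<close>
    show "\<exists>J (V :: ('s \<Rightarrow> 'k, 'm) module).
        regular_Jclass J \<and> simple_module (semigroup_algebra (Hclass (idem_of J))) V \<and>
        module_isomorphic (semigroup_algebra UNIV) M (Ind (idem_of J) V)"
      using J simple_corner[OF simple e(1) apex] isomorphic_Ind_corner[OF simple e(1) apex] by blast
  next
    fix J J' and V :: "('s \<Rightarrow> 'k, 'v) module" and V' :: "('s \<Rightarrow> 'k, 'w) module"
    assume *: "regular_Jclass J \<and> simple_module (semigroup_algebra (Hclass (idem_of J))) V \<and>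
        regular_Jclass J' \<and> simple_module (semigroup_algebra (Hclass (idem_of J'))) V' \<and>
        module_isomorphic (semigroup_algebra UNIV) (Ind (idem_of J) V) (Ind (idem_of J') V')"
    have e: "idem_of J \<in> J" "idem_of J * idem_of J = idem_of J"
      "idem_of J' \<in> J'" "idem_of J' * idem_of J' = idem_of J'"
      using * assms(3) by blast+
    have V: "left_module (semigroup_algebra (Hclass (idem_of J))) V" "carrier V \<noteq> {\<zero>\<^bsub>V\<^esub>}"
      "left_module (semigroup_algebra (Hclass (idem_of J'))) V'" "carrier V' \<noteq> {\<zero>\<^bsub>V'\<^esub>}"
      using * by (simp_all add: simple_module_def)
    have iso: "module_isomorphic algebra (Ind (idem_of J) V) (Ind (idem_of J') V')" using * by blast
    interpret I: induction_data E "idem_of J" V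
      by (intro induction_data.intro induction_data_axioms.intro right_restriction_EI_axioms e V)
    \<comment> \<open>One inclusion comes from the isomorphism and the other from its
      inverse.\<close>
    have "ideal1 (idem_of J) = ideal1 (idem_of J')"
      using Ind_isomorphic_ideal1[OF e(2) V(1,2) e(4) V(3) iso]
        Ind_isomorphic_ideal1[OF e(4) V(3,4) e(2) V(1)
          module_isomorphic_sym[OF I.ind.left_module_axioms iso]] by blast
    moreover have "J = Jclass (idem_of J)" "J' = Jclass (idem_of J')"
      using * e(1,3) by (auto simp: regular_Jclass_def Jclass_def)
    ultimately show JJ': "J = J'" by (simp add: Jclass_def)
    show "module_isomorphic (semigroup_algebra (Hclass (idem_of J))) V V'"
      using Ind_isomorphic_imp_isomorphic[OF e(2) V(1), of V'] V(3) iso unfolding JJ' by blast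
  }
qed

end
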